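(* Let $k\geq 2$ be an integer and let $G$ be a graph on $n$ vertices. If $G$ has minimum degree $\delta(G)>\frac{3n}{4k}$ and $G$ has odd girth at least $2k+1$, then $G$ is homomorphic to $C_{2k+1}$.
   Context: All graphs are finite and simple, without loops. $C_r$ denotes the cycle of length $r$ (on $r$ vertices). A graph $G$ has odd girth at least $g$ if it contains no odd cycle of length less than $g$ (as a not necessarily induced subgraph); in particular, bipartite graphs have odd girth at least $g$ for every $g$. A homomorphism from a graph $G$ into a graph $H$ is a mapping $\varphi\colon V(G)\to V(H)$ such that $\{\varphi(u),\varphi(w)\}\in E(H)$ whenever $\{u,w\}\in E(G)$; $G$ is homomorphic to $H$ if there exists a homomorphism from $G$ into $H$. *)

theory Defs
  imports Complex_Main "Graph_Theory.Graph_Theory"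
begin

text \<open>
  A finite simple graph is a \<^locale>\<open>pair_graph\<close>: a finite vertex set together with a symmetric
  and irreflexive set of ordered pairs, an edge \<open>{u, w}\<close> being represented by the two arcs
  \<open>(u, w)\<close> and \<open>(w, u)\<close>. Hence the degree of a vertex is its \<^const>\<open>out_degree\<close>.
\<close>

text \<open>The value is unspecified for the graph without vertices.\<close>

definition min_degree :: "'a pair_pre_digraph \<Rightarrow> nat" where
  "min_degree G = Min ((\<lambda>v. out_degree (with_proj G) v) ` pverts G)"

text \<open>
  The predicate \<^const>\<open>pre_digraph.cycle\<close> also accepts the closed walks \<open>a, b, a\<close> along a single
  edge; they have even length, so for odd lengths (and without loops) it describes exactly
  the cycles of the undirected graph, as not necessarily induced subgraphs.
\<close>

definition odd_girth_at_least :: "'a pair_pre_digraph \<Rightarrow> nat \<Rightarrow> bool" where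
  "odd_girth_at_least G g \<longleftrightarrow>
     \<not> (\<exists>p. pre_digraph.cycle (with_proj G) p \<and> odd (length p) \<and> length p < g)"

definition graph_hom :: "'a pair_pre_digraph \<Rightarrow> 'b pair_pre_digraph \<Rightarrow> ('a \<Rightarrow> 'b) \<Rightarrow> bool" where
  "graph_hom G H \<phi> \<longleftrightarrow>
     (\<forall>v\<in>pverts G. \<phi> v \<in> pverts H) \<and>
     (\<forall>u w. (u, w) \<in> parcs G \<longrightarrow> (\<phi> u, \<phi> w) \<in> parcs H)"

definition homomorphic_to :: "'a pair_pre_digraph \<Rightarrow> 'b pair_pre_digraph \<Rightarrow> bool" where
  "homomorphic_to G H \<longleftrightarrow> (\<exists>\<phi>. graph_hom G H \<phi>)"

text \<open>This is the cycle of length \<open>r\<close> for \<open>r \<ge> 3\<close> only.\<close>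

definition cycle_graph :: "nat \<Rightarrow> nat pair_pre_digraph" where
  "cycle_graph r =
     \<lparr> pverts = {0..<r},
       parcs = {(i, j). i < r \<and> j < r \<and> (j = Suc i mod r \<or> i = Suc j mod r)} \<rparr>"

lemma pair_graph_cycle_graph:
  assumes "3 \<le> r"
  shows "pair_graph (cycle_graph r)"
proof -
  have ne: "i \<noteq> Suc i mod r" if "i < r" for i
  proof (cases "Suc i = r")
    case True
    then have "Suc i mod r = 0" by simp
    with True assms show ?thesis by linarith
  next
    case False
    with that have "Suc i mod r = Suc i" by simp
    then show ?thesis by linarith
  qed
  have arcs: "(i, j) \<in> parcs (cycle_graph r) \<longleftrightarrow>
      i < r \<and> j < r \<and> (j = Suc i mod r \<or> i = Suc j mod r)" for i j
    unfolding cycle_graph_def by simp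
  have verts: "pverts (cycle_graph r) = {0..<r}"
    unfolding cycle_graph_def by simp
  have sub: "parcs (cycle_graph r) \<subseteq> {0..<r} \<times> {0..<r}"
  proof (rule subrelI)
    fix i j assume "(i, j) \<in> parcs (cycle_graph r)"
    then have "i < r" "j < r" unfolding arcs by blast+
    then show "(i, j) \<in> {0..<r} \<times> {0..<r}" by simp
  qed
  have loopfree: "i \<noteq> j" if "(i, j) \<in> parcs (cycle_graph r)" for i j
    using that ne unfolding arcs by blast
  have "sym (parcs (cycle_graph r))"
    by (rule symI) (use arcs in blast)
  then have symm: "symmetric (with_proj (cycle_graph r))"
    unfolding symmetric_def by simp
  show ?thesis
  proof
    fix e assume e: "e \<in> parcs (cycle_graph r)"
    show "fst e \<in> pverts (cycle_graph r)" "snd e \<in> pverts (cycle_graph r)"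
      using subsetD[OF sub e] unfolding verts by (simp_all add: mem_Times_iff)
    show "fst e \<noteq> snd e"
      using loopfree[of "fst e" "snd e"] e by simp
  next
    show "finite (pverts (cycle_graph r))" unfolding verts by simp
    show "finite (parcs (cycle_graph r))" using sub by (rule finite_subset) simp
    show "symmetric (with_proj (cycle_graph r))" by (rule symm)
  qed
qed

end

theory Submission
  imports Defs
begin

text \<open>
  Adding edges does not lower degrees, so let \<open>G\<close> be edge-maximal among the graphs without an odd
  closed walk shorter than \<open>2k + 1\<close>. Then two non-adjacent vertices are joined by a walk of length
  exactly \<open>2k - 2\<close>. The degree condition enters only through double counting: any \<open>4k\<close> vertices, with
  repetitions, contain four neighbours of a common vertex \<open>z\<close>. On a closed walk of length \<open>2k + 1\<close> a
  vertex has at most two neighbours, and they are two steps apart.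

  Counting on a hexagon with exactly one long diagonal, completed by two walks of length \<open>2k - 2\<close>, gives
  a contradiction, so such hexagons do not occur. Next consider subdivisions of \<open>K\<^sub>4\<close> in which three
  of the faces, those at a vertex \<open>o\<close>, have length \<open>2k + 1\<close>. If the legs at \<open>o\<close> have total length
  \<open>s\<close>, the fourth face has length \<open>3(2k + 1) - 2s\<close>; hence \<open>s \<le> 2k + 1\<close>, and the subdivision has
  \<open>6k + 1 - s \<ge> 4k\<close> vertices. When \<open>s\<close> is maximal, however, a vertex \<open>z\<close> with four neighbours in it
  allows one of the legs to be prolonged or closes a short odd walk. So there is no such subdivision.

  Finally let \<open>C\<close> be a closed walk of length \<open>2k + 1\<close>, which exists unless \<open>G\<close> is bipartite. If every
  vertex has neighbours \<open>C i\<close> and \<open>C (i + 2)\<close> for some \<open>i\<close>, then mapping it to \<open>i\<close> is a homomorphism.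
  Otherwise some vertex \<open>x\<close> without this property is adjacent to a vertex \<open>y\<close> with it; exchanging \<open>y\<close>
  for \<open>C (i + 1)\<close> and joining \<open>x\<close> to the two vertices at distance two from \<open>y\<close> on \<open>C\<close> by walks of length
  \<open>2k - 2\<close> gives a subdivision of \<open>K\<^sub>4\<close> as above, with legs of lengths \<open>2, 1, 2\<close>.
\<close>

section \<open>Walks and edge-maximal supergraphs\<close>

lemma relpow_sym:
  assumes "sym R" "(u, v) \<in> R ^^ n"
  shows "(v, u) \<in> R ^^ n"
  using assms(2)
proof (induction n arbitrary: v)
  case (Suc n)
  then obtain w where "(u, w) \<in> R ^^ n" "(w, v) \<in> R" by auto
  then show ?case using Suc.IH assms(1) by (meson relpow_Suc_I2 symD)
qed simp

lemma walk_leaves_set: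
  assumes "(u, v) \<in> R ^^ n" "P u" "\<not> P v"
  shows "\<exists>x y. (x, y) \<in> R \<and> P x \<and> \<not> P y"
  using assms
proof (induction n arbitrary: v)
  case (Suc n)
  then obtain w where "(u, w) \<in> R ^^ n" "(w, v) \<in> R" by auto
  with Suc show ?case by (cases "P w") auto
qed simp

text \<open>Both new arcs meet \<open>u\<close>, so a walk that leaves \<open>R\<close> visits
  \<open>u\<close>. A closed walk can therefore be rotated to start at \<open>u\<close>.\<close>

lemma relpow_through:
  assumes "(x, y) \<in> (R \<union> {(u, v), (v, u)}) ^^ n"
  shows "(x, y) \<in> R ^^ n \<or>
    (\<exists>i\<le>n. (x, u) \<in> (R \<union> {(u, v), (v, u)}) ^^ i \<and> (u, y) \<in> (R \<union> {(u, v), (v, u)}) ^^ (n - i))"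
  using assms
proof (induction n arbitrary: y)
  case (Suc n)
  let ?S = "R \<union> {(u, v), (v, u)}"
  from Suc.prems obtain w where w: "(x, w) \<in> ?S ^^ n" "(w, y) \<in> ?S" by auto
  from Suc.IH[OF w(1)] show ?case
  proof
    assume a: "(x, w) \<in> R ^^ n"
    show ?case
    proof (cases "w = u \<or> y = u")
      case True
      then show ?thesis
      proof
        assume "w = u"
        then have "(x, u) \<in> ?S ^^ n" "(u, y) \<in> ?S ^^ (Suc n - n)" using w by auto
        then show ?thesis by (intro disjI2 exI[of _ n]) simp
      next
        assume "y = u"
        then have "(x, u) \<in> ?S ^^ Suc n" "(u, y) \<in> ?S ^^ (Suc n - Suc n)" using Suc.prems by auto
        then show ?thesis by (intro disjI2 exI[of _ "Suc n"]) simp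
      qed
    next
      case False
      then have "(w, y) \<in> R" using w(2) by auto
      with a show ?thesis by auto
    qed
  next
    assume "\<exists>i\<le>n. (x, u) \<in> ?S ^^ i \<and> (u, w) \<in> ?S ^^ (n - i)"
    then obtain i where i: "i \<le> n" "(x, u) \<in> ?S ^^ i" "(u, w) \<in> ?S ^^ (n - i)" by blast
    then have "(u, y) \<in> ?S ^^ (Suc n - i)"
      using relpow_Suc_I[OF i(3) w(2)] by (simp add: Suc_diff_le)
    with i show ?case by (meson le_SucI)
  qed
qed simp

text \<open>
  Follow a walk from \<open>u\<close> in the enlarged graph and keep only its part after the last use of the
  new edge \<open>uv\<close>: the parity of what was dropped depends only on the end of \<open>uv\<close> where it stopped.
\<close>

lemma relpow_insert_edge:
  assumes sym: "sym R"
    and closed: "\<And>x n. (x, x) \<in> R ^^ n \<Longrightarrow> odd n \<Longrightarrow> L \<le> n"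
    and uv: "\<And>n. (u, v) \<in> R ^^ n \<Longrightarrow> even n \<Longrightarrow> L \<le> Suc n"
    and "n < L" "(u, y) \<in> (R \<union> {(u, v), (v, u)}) ^^ n"
  shows "(\<exists>m\<le>n. even m = even n \<and> (u, y) \<in> R ^^ m) \<or>
    (\<exists>m<n. even m = odd n \<and> (v, y) \<in> R ^^ m)"
  using assms(4,5)
proof (induction n arbitrary: y)
  case (Suc n)
  then obtain w where w: "(u, w) \<in> (R \<union> {(u, v), (v, u)}) ^^ n"
    "(w, y) \<in> R \<union> {(u, v), (v, u)}" by auto
  have "n < L" using Suc.prems by simp
  note IH = Suc.IH[OF this w(1)]
  consider "(w, y) \<in> R" | "w = u" "y = v" | "w = v" "y = u" using w(2) by auto
  then show ?case
  proof cases
    case 1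
    from IH show ?thesis
    proof
      assume "\<exists>m\<le>n. even m = even n \<and> (u, w) \<in> R ^^ m"
      then obtain m where m: "m \<le> n" "even m = even n" "(u, w) \<in> R ^^ m" by blast
      then have "(u, y) \<in> R ^^ Suc m" using 1 by auto
      with m show ?thesis by (metis Suc_le_mono even_Suc)
    next
      assume "\<exists>m<n. even m = odd n \<and> (v, w) \<in> R ^^ m"
      then obtain m where m: "m < n" "even m = odd n" "(v, w) \<in> R ^^ m" by blast
      then have "(v, y) \<in> R ^^ Suc m" using 1 by auto
      with m show ?thesis by (metis Suc_less_eq even_Suc)
    qed
  next
    case 2
    have "even n"
    proof (rule ccontr)
      assume "odd n"
      from IH show False
      proof
        assume "\<exists>m\<le>n. even m = even n \<and> (u, w) \<in> R ^^ m"
        then show False using closed[of u] \<open>odd n\<close> \<open>n < L\<close> 2 by fastforce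
      next
        assume "\<exists>m<n. even m = odd n \<and> (v, w) \<in> R ^^ m"
        then obtain m where "m < n" "even m" "(v, u) \<in> R ^^ m" using \<open>odd n\<close> 2 by auto
        then show False using uv[of m] relpow_sym[OF sym] \<open>n < L\<close> by fastforce
      qed
    qed
    then show ?thesis using 2 by (intro disjI2 exI[of _ 0]) auto
  next
    case 3
    have "odd n"
    proof (rule ccontr)
      assume "\<not> odd n"
      from IH show False
      proof
        assume "\<exists>m\<le>n. even m = even n \<and> (u, w) \<in> R ^^ m"
        then obtain m where "m \<le> n" "even m" "(u, v) \<in> R ^^ m" using \<open>\<not> odd n\<close> 3 by auto
        then show False using uv[of m] Suc.prems(1) by fastforce
      next
        assume "\<exists>m<n. even m = odd n \<and> (v, w) \<in> R ^^ m"
        then show False using closed[of v] \<open>\<not> odd n\<close> \<open>n < L\<close> 3 by fastforce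
      qed
    qed
    then show ?thesis using 3 by (intro disjI1 exI[of _ 0]) auto
  qed
qed auto

text \<open>Rotated to \<open>u\<close>, a short odd closed walk reduces to an odd closed walk in
  \<open>R\<close> or to an even walk in \<open>R\<close> between \<open>u\<close> and
  \<open>v\<close>; either would be too short.\<close>

lemma insert_edge_no_short_odd_closed:
  assumes sym: "sym R"
    and closed: "\<And>x n. (x, x) \<in> R ^^ n \<Longrightarrow> odd n \<Longrightarrow> L \<le> n"
    and uv: "\<And>n. (u, v) \<in> R ^^ n \<Longrightarrow> even n \<Longrightarrow> L \<le> Suc n"
    and walk: "(x, x) \<in> (R \<union> {(u, v), (v, u)}) ^^ n" "odd n"
  shows "L \<le> n"
proof (rule ccontr)
  let ?S = "R \<union> {(u, v), (v, u)}"
  assume "\<not> L \<le> n"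
  then have "n < L" by simp
  from relpow_through[OF walk(1)] closed walk(2) \<open>\<not> L \<le> n\<close>
  obtain i where i: "i \<le> n" "(x, u) \<in> ?S ^^ i" "(u, x) \<in> ?S ^^ (n - i)" by blast
  have "(u, u) \<in> ?S ^^ n" using relpow_trans[OF i(3,2)] i(1) by simp
  from relpow_insert_edge[OF sym closed uv \<open>n < L\<close> this] show False
  proof
    assume "\<exists>m\<le>n. even m = even n \<and> (u, u) \<in> R ^^ m"
    then show False using closed[of u] walk(2) \<open>n < L\<close> by fastforce
  next
    assume "\<exists>m<n. even m = odd n \<and> (v, u) \<in> R ^^ m"
    then obtain m where "m < n" "even m" "(v, u) \<in> R ^^ m" using walk(2) by auto
    then show False using uv[of m] relpow_sym[OF sym] \<open>n < L\<close> by fastforce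
  qed
qed

text \<open>Take a maximal member of the finite family of admissible supergraphs. Adding a missing
  pair, possibly with \<open>u = v\<close>, leaves the family, and by the insertion lemma only a
  short even walk can be the cause.\<close>

lemma saturate:
  fixes L :: nat
  assumes "finite V" "R \<subseteq> V \<times> V" "sym R"
    and "\<And>x n. (x, x) \<in> R ^^ n \<Longrightarrow> odd n \<Longrightarrow> L \<le> n"
  obtains S where "R \<subseteq> S" "S \<subseteq> V \<times> V" "sym S"
    "\<forall>x n. (x, x) \<in> S ^^ n \<longrightarrow> odd n \<longrightarrow> L \<le> n"
    "\<forall>u\<in>V. \<forall>v\<in>V. (u, v) \<notin> S \<longrightarrow> (\<exists>n. even n \<and> Suc n < L \<and> (u, v) \<in> S ^^ n)"
proof -
  define F where "F = {S. R \<subseteq> S \<and> S \<subseteq> V \<times> V \<and> sym S \<and> (\<forall>x n. (x, x) \<in> S ^^ n \<longrightarrow> odd n \<longrightarrow> L \<le> n)}"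
  have "finite F"
    by (rule finite_subset[of _ "Pow (V \<times> V)"]) (use assms(1) in \<open>auto simp: F_def\<close>)
  moreover have "R \<in> F" using assms by (auto simp: F_def)
  ultimately obtain S where S: "S \<in> F" "\<And>T. T \<in> F \<Longrightarrow> S \<subseteq> T \<Longrightarrow> S = T"
    using finite_has_maximal[of F] by blast
  show thesis
  proof (rule that[of S])
    show "\<forall>u\<in>V. \<forall>v\<in>V. (u, v) \<notin> S \<longrightarrow> (\<exists>n. even n \<and> Suc n < L \<and> (u, v) \<in> S ^^ n)"
    proof (intro ballI impI, rule ccontr)
      fix u v assume uv: "u \<in> V" "v \<in> V" "(u, v) \<notin> S"
      assume no: "\<nexists>n. even n \<and> Suc n < L \<and> (u, v) \<in> S ^^ n"
      let ?T = "S \<union> {(u, v), (v, u)}"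
      have "L \<le> n" if "(x, x) \<in> ?T ^^ n" "odd n" for x n
        by (rule insert_edge_no_short_odd_closed[OF _ _ _ that])
          (use S(1) no in \<open>auto simp: F_def not_less\<close>)
      moreover have "sym ?T" using S(1) by (auto simp: F_def sym_def)
      ultimately have "?T \<in> F" using S(1) uv by (auto simp: F_def)
      with S(2)[of ?T] uv(3) show False by auto
    qed
  qed (use S(1) in \<open>auto simp: F_def\<close>)
qed

text \<open>A closed walk splits at a repeated vertex into two shorter closed walks, one of which is
  odd.\<close>

lemma (in pair_wf_digraph) odd_closed_walk_imp_odd_cycle:
  assumes "awalk u p u" "odd (length p)"
  shows "\<exists>c. cycle c \<and> odd (length c) \<and> length c \<le> length p"
  using assms
proof (induction "length p" arbitrary: u p rule: less_induct)
  case less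
  then obtain e p' where p: "p = e # p'" by (cases p) auto
  show ?case
  proof (cases "distinct (tl (pawalk_verts u p))")
    case True
    with less.prems p show ?thesis unfolding cycle_def by blast
  next
    case False
    \<comment> \<open>The start is listed again at the end, and \<open>cycle\<close> demands
      distinctness only behind the first entry. The repetition is therefore located in
      \<open>p'\<close>, the walk without its first arc.\<close>
    from less.prems(1) have e: "awalk u [e] (snd e)" "awalk (snd e) p' u"
      unfolding p by (auto simp: awalk_Cons_iff awalk_Nil_iff intro: arc_snd_in_verts)
    have "\<not> distinct (pawalk_verts (snd e) p')" using False unfolding p by simp
    from awalk_not_distinct_decomp[OF e(2) this] obtain q r s w where
      d: "p' = q @ r @ s" "0 < length r" "awalk (snd e) q w" "awalk w r w" "awalk w s u" by blast
    have "awalk u (e # q @ s) u"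
      using e(1) d(3,5) by (auto simp: awalk_Cons_iff awalk_append_iff)
    moreover have "odd (length r) \<or> odd (length (e # q @ s))"
      using less.prems(2) unfolding p d(1) by auto
    moreover have len: "length r < length p" "length (e # q @ s) < length p"
      using d(2) unfolding p d(1) by auto
    ultimately obtain c where "cycle c" "odd (length c)"
      "length c \<le> length r \<or> length c \<le> length (e # q @ s)"
      using less.hyps[OF len(1) d(4)] less.hyps[OF len(2)] by blast
    with len show ?thesis by (intro exI[of _ c]) linarith
  qed
qed

lemma (in pair_wf_digraph) relpow_imp_awalk:
  assumes "(u, v) \<in> parcs G ^^ n" "u \<in> pverts G"
  shows "\<exists>p. awalk u p v \<and> length p = n"
  using assms
proof (induction n arbitrary: v)
  case 0
  then show ?case by (auto simp: awalk_Nil_iff)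
next
  case (Suc n)
  then obtain w where w: "(u, w) \<in> parcs G ^^ n" "(w, v) \<in> parcs G" by auto
  with Suc obtain p where "awalk u p w" "length p = n" by blast
  with w(2) have "awalk u (p @ [(w, v)]) v" "length (p @ [(w, v)]) = Suc n"
    by (auto simp: awalk_append_iff awalk_Cons_iff awalk_Nil_iff dest: in_arcsD1 in_arcsD2)
  then show ?case by blast
qed

lemma two_elements:
  assumes "2 \<le> card A"
  obtains s t :: nat where "s \<in> A" "t \<in> A" "s < t"
proof -
  have "finite A" "\<not> card A \<le> Suc 0" using assms card.infinite[of A] by fastforce+
  then obtain s t where "s \<in> A" "t \<in> A" "s \<noteq> t" using card_le_Suc0_iff_eq[of A] by blast
  then show thesis using that[of s t] that[of t s] by (cases s t rule: linorder_cases) auto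
qed

text \<open>The alternatives are the patterns 2+2 and 2+1+1 in all cyclic positions, in the form
  that \<open>no_interior_neighbours\<close> refutes after rotation.\<close>

lemma three_summands_ge_4:
  fixes x y w :: nat
  assumes "x \<le> 2" "y \<le> 2" "w \<le> 2" "4 \<le> x + y + w"
  shows "2 \<le> y \<and> 2 \<le> w \<or> 2 \<le> w \<and> 2 \<le> x \<or> 2 \<le> x \<and> 2 \<le> y \<or>
    2 \<le> y \<and> 1 \<le> w \<and> 1 \<le> x \<or> 2 \<le> w \<and> 1 \<le> x \<and> 1 \<le> y \<or> 2 \<le> x \<and> 1 \<le> y \<and> 1 \<le> w"
proof -
  have *: "n = 0 \<or> n = 1 \<or> n = 2" if "n \<le> 2" for n :: nat using that by linarith
  show ?thesis
    using *[OF assms(1)] *[OF assms(2)] *[OF assms(3)] assms(4) by (elim disjE; hypsubst; simp)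
qed

section \<open>Edge-maximal graphs of large odd girth\<close>

text \<open>Walks of length 1 in \<open>odd_closed\<close> exclude loops. In
  \<open>saturated\<close> the length \<open>n\<close> is even and below \<open>2 * k\<close>, hence
  at most \<open>2 * k - 2\<close>.\<close>

locale saturated_graph =
  fixes V :: "'a set" and R :: "'a rel" and k :: nat
  assumes k_ge_2: "2 \<le> k"
    and finite_V: "finite V"
    and R_subset: "R \<subseteq> V \<times> V"
    and sym_R: "sym R"
    and degree: "\<And>v. v \<in> V \<Longrightarrow> 3 * card V < 4 * k * card (R `` {v})"
    and odd_closed: "\<And>v n. (v, v) \<in> R ^^ n \<Longrightarrow> odd n \<Longrightarrow> 2 * k + 1 \<le> n"
    and saturated: "\<And>u v. u \<in> V \<Longrightarrow> v \<in> V \<Longrightarrow> (u, v) \<notin> R \<Longrightarrow>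
      \<exists>n. even n \<and> Suc n < 2 * k + 1 \<and> (u, v) \<in> R ^^ n"
begin

abbreviation (input) L :: nat where "L \<equiv> 2 * k + 1"

text \<open>Positions \<open>0\<close> and \<open>L\<close> are the same vertex, so the walk is
  counted over the positions \<open>0\<close> to \<open>2 * k\<close>; vertices may repeat there,
  and values beyond \<open>L\<close> are arbitrary.\<close>

definition closed_walk :: "(nat \<Rightarrow> 'a) \<Rightarrow> bool" where
  "closed_walk X \<longleftrightarrow> (\<forall>t<L. (X t, X (Suc t)) \<in> R) \<and> X L = X 0"

section \<open>Parity and distances on closed walks\<close>

lemma adj_sym: "(u, v) \<in> R \<Longrightarrow> (v, u) \<in> R"
  using sym_R by (rule symD)

lemma adj_V: "(u, v) \<in> R \<Longrightarrow> u \<in> V" "(u, v) \<in> R \<Longrightarrow> v \<in> V"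
  using R_subset by auto

text \<open>Two walks with common ends and lengths of different parity form an odd closed walk; most
  length estimates below rest on this.\<close>

lemma parity:
  assumes "(u, v) \<in> R ^^ m" "(u, v) \<in> R ^^ n" "odd (m + n)"
  shows "L \<le> m + n"
  using odd_closed[OF relpow_trans[OF assms(1) relpow_sym[OF sym_R assms(2)]] assms(3)] .

lemma neighbours_parity:
  assumes "(z, p) \<in> R" "(z, q) \<in> R" "(p, q) \<in> R ^^ m" "odd m"
  shows "L \<le> m + 2"
proof -
  have "(p, q) \<in> R ^^ 2" using assms(1,2) adj_sym by (auto simp: numeral_2_eq_2)
  from parity[OF assms(3) this] assms(4) show ?thesis by simp
qed

lemma adj_parity:
  assumes "(p, q) \<in> R" "(p, q) \<in> R ^^ m" "even m"
  shows "L \<le> m + 1"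
  using parity[OF assms(2), of 1] assms(1,3) by simp

lemma walk_segment:
  assumes "\<And>t. i \<le> t \<Longrightarrow> t < j \<Longrightarrow> (X t, X (Suc t)) \<in> R" "i \<le> j"
  shows "(X i, X j) \<in> R ^^ (j - i)"
  unfolding relpow_fun_conv using assms by (intro exI[of _ "\<lambda>t. X (i + t)"]) auto

lemma closed_walk_segment:
  assumes "closed_walk X" "i \<le> j" "j \<le> L"
  shows "(X i, X j) \<in> R ^^ (j - i)" "(X j, X i) \<in> R ^^ (j - i)"
proof -
  show "(X i, X j) \<in> R ^^ (j - i)"
    by (rule walk_segment) (use assms in \<open>auto simp: closed_walk_def\<close>)
  then show "(X j, X i) \<in> R ^^ (j - i)" by (rule relpow_sym[OF sym_R])
qed

lemma closed_walk_back:
  assumes "closed_walk X" "i \<le> L"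
  shows "(X i, X 0) \<in> R ^^ (L - i)" "(X 0, X i) \<in> R ^^ (L - i)"
proof -
  show "(X i, X 0) \<in> R ^^ (L - i)"
    using closed_walk_segment(1)[OF assms(1), of i L] assms by (simp add: closed_walk_def)
  then show "(X 0, X i) \<in> R ^^ (L - i)" by (rule relpow_sym[OF sym_R])
qed

lemma closed_walk_around:
  assumes "closed_walk X" "i \<le> j" "j \<le> L"
  shows "(X i, X j) \<in> R ^^ (L - (j - i))"
proof -
  have "(X i, X j) \<in> R ^^ (i + (L - j))"
    using relpow_trans[OF closed_walk_segment(2)[OF assms(1), of 0 i]
        closed_walk_back(2)[OF assms(1), of j]] assms by simp
  moreover have "i + (L - j) = L - (j - i)" using assms by simp
  ultimately show ?thesis by metis
qed

text \<open>One of the two arcs of \<open>X\<close> between the neighbours is odd and closes an odd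
  walk through \<open>z\<close>, so it has at least \<open>2k - 1\<close> edges. The other arc is
  even and thus has exactly two; in the second alternative it passes position
  \<open>0\<close>.\<close>

lemma closed_walk_neighbours:
  assumes "closed_walk X" "s < t" "t \<le> 2 * k" "(z, X s) \<in> R" "(z, X t) \<in> R"
  shows "t = s + 2 \<or> t + 1 = s + 2 * k"
proof (cases "odd (t - s)")
  case True
  have "L \<le> t - s + 2"
    by (rule neighbours_parity[OF assms(4,5) closed_walk_segment(1) True]) (use assms in auto)
  moreover have "t - s \<noteq> 2 * k" using True by (metis dvd_triv_left)
  ultimately show ?thesis using assms by auto
next
  case False
  have "L \<le> L - (t - s) + 2"
    by (rule neighbours_parity[OF assms(4,5) closed_walk_around])
      (use assms False in \<open>auto\<close>)
  moreover have "t - s \<noteq> 1" using False by (metis odd_one)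
  ultimately show ?thesis using assms by auto
qed

lemma closed_walk_chord:
  assumes "closed_walk X" "s < t" "t \<le> 2 * k" "(X s, X t) \<in> R"
  shows "t = s + 1 \<or> t = s + 2 * k"
proof (cases "even (t - s)")
  case True
  have "L \<le> t - s + 1"
    by (rule adj_parity[OF assms(4) closed_walk_segment(1) True]) (use assms in auto)
  then show ?thesis using assms by auto
next
  case False
  have "L \<le> L - (t - s) + 1"
    by (rule adj_parity[OF assms(4) closed_walk_around])
      (use assms False in \<open>auto\<close>)
  then show ?thesis using assms by auto
qed

text \<open>Three neighbours would be pairwise two steps apart around the walk, which forces its
  length to be 6.\<close>

lemma card_closed_walk_neighbours:
  assumes "closed_walk X"
  shows "card {t. t \<le> 2 * k \<and> (z, X t) \<in> R} \<le> 2"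
proof (rule ccontr)
  let ?A = "{t. t \<le> 2 * k \<and> (z, X t) \<in> R}"
  assume "\<not> card ?A \<le> 2"
  then have "3 \<le> card ?A" by simp
  moreover define m where "m = Min ?A"
  moreover have fin: "finite ?A" by simp
  ultimately have m: "m \<in> ?A" "\<And>t. t \<in> ?A \<Longrightarrow> m \<le> t"
    using Min_in[OF fin] by (fastforce simp: m_def)+
  have "2 \<le> card (?A - {m})" using \<open>3 \<le> card ?A\<close> m(1) fin by (simp add: card_Diff_singleton)
  then obtain s t where st: "s \<in> ?A - {m}" "t \<in> ?A - {m}" "s < t" by (rule two_elements)
  then have "m < s" using m(2)[of s] by force
  have "s = m + 2 \<or> s + 1 = m + 2 * k" "t = s + 2 \<or> t + 1 = s + 2 * k"
    "t = m + 2 \<or> t + 1 = m + 2 * k"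
    using closed_walk_neighbours[OF assms \<open>m < s\<close>, of z] closed_walk_neighbours[OF assms \<open>s < t\<close>, of z]
      closed_walk_neighbours[OF assms, of m t z] st m(1) \<open>m < s\<close> by simp_all
  moreover have "t \<le> 2 * k" using st(2) by simp
  ultimately show False using st(3) \<open>m < s\<close> k_ge_2 by (elim disjE) (linarith | presburger)+
qed

section \<open>Double counting of neighbours\<close>

lemma sum_card_neighbours:
  assumes "finite A" "f ` A \<subseteq> V"
  shows "3 * card V * card A \<le> 4 * k * (\<Sum>z\<in>V. card {t \<in> A. (z, f t) \<in> R})"
    and "V \<noteq> {} \<Longrightarrow> A \<noteq> {} \<Longrightarrow> 3 * card V * card A < 4 * k * (\<Sum>z\<in>V. card {t \<in> A. (z, f t) \<in> R})"
proof -
  have "(\<Sum>z\<in>V. card {t \<in> A. (z, f t) \<in> R}) = (\<Sum>z\<in>V. \<Sum>t\<in>A. of_bool ((z, f t) \<in> R))"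
    using assms(1) by (auto intro!: sum.cong simp: Int_def)
  also have "\<dots> = (\<Sum>t\<in>A. \<Sum>z\<in>V. of_bool ((z, f t) \<in> R))" by (rule sum.swap)
  also have "\<dots> = (\<Sum>t\<in>A. card (R `` {f t}))"
  proof (rule sum.cong)
    fix t
    have "V \<inter> {z. (z, f t) \<in> R} = R `` {f t}" using adj_sym adj_V by auto
    then show "(\<Sum>z\<in>V. of_bool ((z, f t) \<in> R)) = card (R `` {f t})"
      using finite_V by simp
  qed simp
  finally have eq: "4 * k * (\<Sum>z\<in>V. card {t \<in> A. (z, f t) \<in> R}) = (\<Sum>t\<in>A. 4 * k * card (R `` {f t}))"
    by (simp add: sum_distrib_left)
  have *: "3 * card V < 4 * k * card (R `` {f t})" if "t \<in> A" for t
    using that assms(2) by (intro degree) auto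
  have c: "3 * card V * card A = (\<Sum>t\<in>A. 3 * card V)" by simp
  show "3 * card V * card A \<le> 4 * k * (\<Sum>z\<in>V. card {t \<in> A. (z, f t) \<in> R})"
    unfolding eq c by (rule sum_mono) (use * in \<open>auto intro: less_imp_le\<close>)
  show "3 * card V * card A < 4 * k * (\<Sum>z\<in>V. card {t \<in> A. (z, f t) \<in> R})"
    if "V \<noteq> {}" "A \<noteq> {}"
    unfolding eq c by (rule sum_strict_mono) (use * that assms(1) in auto)
qed

text \<open>With at most three neighbours per vertex, the number of adjacent pairs of a vertex and a
  position would be at most \<open>3 * card V\<close>, while \<open>4k\<close> degrees above
  \<open>3 * card V / (4k)\<close> sum to more.\<close>

lemma four_neighbours:
  fixes f g h :: "nat \<Rightarrow> 'a"
  assumes "finite A" "finite B" "finite C" "A \<noteq> {}"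
    and "f ` A \<subseteq> V" "g ` B \<subseteq> V" "h ` C \<subseteq> V"
    and large: "4 * k \<le> card A + card B + card C"
  obtains z where "z \<in> V"
    "4 \<le> card {t \<in> A. (z, f t) \<in> R} + card {t \<in> B. (z, g t) \<in> R} + card {t \<in> C. (z, h t) \<in> R}"
proof (rule ccontr)
  let ?N = "\<lambda>z. card {t \<in> A. (z, f t) \<in> R} + card {t \<in> B. (z, g t) \<in> R} + card {t \<in> C. (z, h t) \<in> R}"
  assume no: "\<not> thesis"
  have "V \<noteq> {}" using assms(4,5) by auto
  have "3 * card V * (card A + card B + card C) < 4 * k * (\<Sum>z\<in>V. ?N z)"
    using sum_card_neighbours(2)[OF assms(1,5) \<open>V \<noteq> {}\<close> assms(4)]
      sum_card_neighbours(1)[OF assms(2,6)] sum_card_neighbours(1)[OF assms(3,7)]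
    by (simp add: sum.distrib algebra_simps)
  also have "(\<Sum>z\<in>V. ?N z) \<le> (\<Sum>z\<in>V. 3)"
    by (rule sum_mono) (use no that in force)
  then have "4 * k * (\<Sum>z\<in>V. ?N z) \<le> 4 * k * (3 * card V)" by (intro mult_left_mono) (simp_all add: mult.commute)
  also have "\<dots> \<le> 3 * card V * (card A + card B + card C)"
    using mult_left_mono[OF large, of "3 * card V"] by (simp add: algebra_simps)
  finally show False by simp
qed

section \<open>Walks of prescribed length between non-adjacent vertices\<close>

lemma has_neighbour:
  assumes "v \<in> V"
  obtains w where "(v, w) \<in> R"
  using degree[OF assms] by (cases "R `` {v} = {}") auto

lemma relpow_pad:
  assumes "(u, v) \<in> R ^^ m" "v \<in> V"
  shows "(u, v) \<in> R ^^ (m + 2 * i)"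
proof (induction i)
  case (Suc i)
  obtain w where "(v, w) \<in> R" using has_neighbour[OF assms(2)] .
  then have "(u, v) \<in> R ^^ Suc (Suc (m + 2 * i))"
    using Suc adj_sym by (meson relpow_Suc_I)
  then show ?case by simp
qed (use assms in simp)

text \<open>The even walk given by saturation is padded by going to and fro along an edge. The
  length \<open>2k - 2\<close> is chosen so that any walk of three edges between the same ends
  completes it to a closed walk of length \<open>L\<close>.\<close>

lemma nonadjacent_walk:
  assumes "u \<in> V" "v \<in> V" "(u, v) \<notin> R"
  shows "(u, v) \<in> R ^^ (2 * k - 2)"
proof -
  obtain n where n: "even n" "Suc n < L" "(u, v) \<in> R ^^ n" using saturated[OF assms] by blast
  then have "n + 2 * ((2 * k - 2 - n) div 2) = 2 * k - 2" by (auto elim!: evenE)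
  with relpow_pad[OF n(3) assms(2)] show ?thesis by metis
qed

lemma nonadjacent_walk_obtain:
  assumes "u \<in> V" "v \<in> V" "(u, v) \<notin> R"
  obtains P where "P 0 = u" "P (2 * k - 2) = v" "\<And>t. t < 2 * k - 2 \<Longrightarrow> (P t, P (Suc t)) \<in> R"
  using nonadjacent_walk[OF assms] unfolding relpow_fun_conv by blast

text \<open>The detour over \<open>a\<close> and \<open>b\<close> closes \<open>P\<close> to length
  \<open>L\<close>. Its two vertices are counted apart from \<open>P\<close>, because in a hexagon
  the same \<open>P\<close> is closed along either side.\<close>

lemma path_face:
  assumes P: "\<And>t. t < 2 * k - 2 \<Longrightarrow> (P t, P (Suc t)) \<in> R"
    and "(P (2 * k - 2), a) \<in> R" "(a, b) \<in> R" "(b, P 0) \<in> R"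
  shows "card {t \<in> {..2 * k - 2}. (z, P t) \<in> R} + of_bool ((z, a) \<in> R) + of_bool ((z, b) \<in> R) \<le> 2"
    and "s < t \<Longrightarrow> t \<le> 2 * k - 2 \<Longrightarrow> (z, P s) \<in> R \<Longrightarrow> (z, P t) \<in> R \<Longrightarrow> t = s + 2"
proof -
  define X where "X t = (if t \<le> 2 * k - 2 then P t else if t = 2 * k - 1 then a
    else if t = 2 * k then b else P 0)" for t
  have "(X t, X (Suc t)) \<in> R" if t: "t < L" for t
  proof -
    consider "t < 2 * k - 2" | "t = 2 * k - 2" | "t = 2 * k - 1" | "t = 2 * k"
      using t by linarith
    then show ?thesis by cases (use assms k_ge_2 in \<open>auto simp: X_def Suc_diff_Suc\<close>)
  qed
  then have X: "closed_walk X" by (auto simp: closed_walk_def X_def)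
  have split: "t \<le> 2 * k \<longleftrightarrow> t \<le> 2 * k - 2 \<or> t = 2 * k - 1 \<or> t = 2 * k" for t
    using k_ge_2 by linarith
  have ne: "\<not> 2 * k - 1 \<le> 2 * k - 2" "\<not> 2 * k \<le> 2 * k - 2" "2 * k \<noteq> 2 * k - 1"
    using k_ge_2 by linarith+
  have ends: "X (2 * k - 1) = a" "X (2 * k) = b" and mid: "t \<le> 2 * k - 2 \<Longrightarrow> X t = P t" for t
    using ne by (simp_all add: X_def)
  have "{t. t \<le> 2 * k \<and> (z, X t) \<in> R} =
      {t \<in> {..2 * k - 2}. (z, P t) \<in> R} \<union> {t. t = 2 * k - 1 \<and> (z, a) \<in> R}
        \<union> {t. t = 2 * k \<and> (z, b) \<in> R}"
    unfolding split using ends by (auto simp: mid)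
  then have "card {t. t \<le> 2 * k \<and> (z, X t) \<in> R} =
      card ({t \<in> {..2 * k - 2}. (z, P t) \<in> R} \<union> {t. t = 2 * k - 1 \<and> (z, a) \<in> R}
        \<union> {t. t = 2 * k \<and> (z, b) \<in> R})" by simp
  also have "\<dots> = card {t \<in> {..2 * k - 2}. (z, P t) \<in> R} + card {t. t = 2 * k - 1 \<and> (z, a) \<in> R}
        + card {t. t = 2 * k \<and> (z, b) \<in> R}"
    using k_ge_2 by (subst card_Un_disjoint; (auto)?)+
  finally show "card {t \<in> {..2 * k - 2}. (z, P t) \<in> R} + of_bool ((z, a) \<in> R) + of_bool ((z, b) \<in> R) \<le> 2"
    using card_closed_walk_neighbours[OF X, of z] by (auto split: if_splits)
  show "t = s + 2" if "s < t" "t \<le> 2 * k - 2" "(z, P s) \<in> R" "(z, P t) \<in> R"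
  proof -
    have "t = s + 2 \<or> t + 1 = s + 2 * k"
      using closed_walk_neighbours[OF X, of s t z] that k_ge_2 by (auto simp: X_def)
    with that k_ge_2 show ?thesis by linarith
  qed
qed

section \<open>Hexagons\<close>

lemma card_neighbour_path:
  fixes m :: nat
  assumes "card {t \<in> {..m}. (z, P t) \<in> R} = 2" "(z, P 0) \<notin> R" "(z, P m) \<notin> R"
  obtains s t where "0 < s" "s < t" "t < m" "(z, P s) \<in> R" "(z, P t) \<in> R"
proof -
  obtain s t where st: "s \<in> {t \<in> {..m}. (z, P t) \<in> R}" "t \<in> {t \<in> {..m}. (z, P t) \<in> R}" "s < t"
    using two_elements[of "{t \<in> {..m}. (z, P t) \<in> R}"] assms(1) by auto
  have "0 < s" using st(1) assms(2) by (cases s) auto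
  moreover have "t < m" using st(2) assms(3) by (cases "t = m") auto
  ultimately show thesis using that[of s t] st by auto
qed

text \<open>If both other long diagonals are missing, their ends are joined by walks
  \<open>P\<close> and \<open>Q\<close> of length \<open>2k - 2\<close>. Closing each of them along
  both sides of the hexagon gives four faces, which restrict a vertex \<open>z\<close> with four
  neighbours.\<close>

lemma hexagon:
  assumes h: "(h0, h1) \<in> R" "(h1, h2) \<in> R" "(h2, h3) \<in> R" "(h3, h4) \<in> R" "(h4, h5) \<in> R" "(h5, h0) \<in> R"
    and chord: "(h0, h3) \<in> R"
  shows "(h1, h4) \<in> R \<or> (h2, h5) \<in> R"
proof (rule ccontr)
  assume "\<not> ?thesis"
  then have no: "(h1, h4) \<notin> R" "(h2, h5) \<notin> R" by auto
  define m where "m = 2 * k - 2"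
  have m: "m + 2 = 2 * k" using k_ge_2 by (simp add: m_def)
  have "even m" using m by presburger
  have V: "h1 \<in> V" "h4 \<in> V" "h2 \<in> V" "h5 \<in> V" "h0 \<in> V" "h3 \<in> V" using h adj_V by blast+
  obtain P where P: "P 0 = h1" "P m = h4" "\<And>t. t < m \<Longrightarrow> (P t, P (Suc t)) \<in> R"
    using nonadjacent_walk_obtain[OF V(1,2) no(1)] unfolding m_def by metis
  obtain Q where Q: "Q 0 = h2" "Q m = h5" "\<And>t. t < m \<Longrightarrow> (Q t, Q (Suc t)) \<in> R"
    using nonadjacent_walk_obtain[OF V(3,4) no(2)] unfolding m_def by metis
  have in_V: "F t \<in> V" if "\<And>t. t < m \<Longrightarrow> (F t, F (Suc t)) \<in> R" "F m \<in> V" "t \<le> m" for F :: "nat \<Rightarrow> 'a" and t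
    using that(1)[of t] that(2,3) adj_V(1) by (cases "t = m") auto
  have PV: "P ` {..m} \<subseteq> V" and QV: "Q ` {..m} \<subseteq> V"
    using in_V[of P] in_V[of Q] P Q V by auto
  let ?H = "\<lambda>i. if i = (0::nat) then h0 else h3"
  \<comment> \<open>Each walk has \<open>2k - 1\<close> positions; the ends of the diagonal supply
    the missing two.\<close>
  have "4 * k \<le> card {..m} + card {..m} + card {0, 1::nat}" using m by simp
  from four_neighbours[OF _ _ _ _ PV QV _ this, of ?H] V(5,6)
  obtain z where z: "4 \<le> card {t \<in> {..m}. (z, P t) \<in> R} + card {t \<in> {..m}. (z, Q t) \<in> R}
      + card {t \<in> {0, 1}. (z, ?H t) \<in> R}" by auto
  have "{t \<in> {0, 1}. (z, ?H t) \<in> R} = {t. t = 0 \<and> (z, h0) \<in> R} \<union> {t. t = 1 \<and> (z, h3) \<in> R}" by auto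
  then have "card {t \<in> {0, 1}. (z, ?H t) \<in> R} = of_bool ((z, h0) \<in> R) + of_bool ((z, h3) \<in> R)" by auto
  with z have z: "4 \<le> card {t \<in> {..m}. (z, P t) \<in> R} + card {t \<in> {..m}. (z, Q t) \<in> R}
      + of_bool ((z, h0) \<in> R) + of_bool ((z, h3) \<in> R)" by simp
  have "\<not> ((z, h0) \<in> R \<and> (z, h3) \<in> R)"
    using neighbours_parity[of z h0 h3 1] chord k_ge_2 by auto
  note faceP = path_face[of P, folded m_def, OF P(3), unfolded P(1,2)]
  note faceQ = path_face[of Q, folded m_def, OF Q(3), unfolded Q(1,2)]
  note F = faceP(1)[of h3 h2 z] faceP(1)[of h5 h0 z] faceQ(1)[of h4 h3 z] faceQ(1)[of h0 h1 z]
  have bounds: "card {t \<in> {..m}. (z, P t) \<in> R} + of_bool ((z, h3) \<in> R) + of_bool ((z, h2) \<in> R) \<le> 2"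
    "card {t \<in> {..m}. (z, P t) \<in> R} + of_bool ((z, h5) \<in> R) + of_bool ((z, h0) \<in> R) \<le> 2"
    "card {t \<in> {..m}. (z, Q t) \<in> R} + of_bool ((z, h4) \<in> R) + of_bool ((z, h3) \<in> R) \<le> 2"
    "card {t \<in> {..m}. (z, Q t) \<in> R} + of_bool ((z, h0) \<in> R) + of_bool ((z, h1) \<in> R) \<le> 2"
    by (rule F; use h adj_sym in blast)+
  \<comment> \<open>A neighbour \<open>h0\<close> or \<open>h3\<close> leaves at most one on each of
    \<open>P\<close> and \<open>Q\<close>, and at most one of these two is a neighbour. So all four
    lie on the walks, which fills every face.\<close>
  have full: "card {t \<in> {..m}. (z, P t) \<in> R} = 2 \<and> card {t \<in> {..m}. (z, Q t) \<in> R} = 2 \<and>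
      (z, h1) \<notin> R \<and> (z, h4) \<notin> R \<and> (z, h2) \<notin> R \<and> (z, h5) \<notin> R"
    using z bounds \<open>\<not> ((z, h0) \<in> R \<and> (z, h3) \<in> R)\<close> by (auto simp: of_bool_def split: if_splits)
  obtain p p' where p: "0 < p" "p < p'" "p' < m" "(z, P p) \<in> R" "(z, P p') \<in> R"
    using card_neighbour_path[of m z P] full P by auto
  obtain q q' where q: "0 < q" "q < q'" "q' < m" "(z, Q q) \<in> R" "(z, Q q') \<in> R"
    using card_neighbour_path[of m z Q] full Q by auto
  have p': "p' = p + 2"
    using faceP(2)[of h3 h2 p p' z] p h adj_sym by auto
  have q': "q' = q + 2"
    using faceQ(2)[of h4 h3 q q' z] q h adj_sym by auto
  have segP: "(P i, P j) \<in> R ^^ (j - i)" if "i \<le> j" "j \<le> m" for i j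
    by (rule walk_segment) (use P(3) that in auto)
  have segQ: "(Q i, Q j) \<in> R ^^ (j - i)" if "i \<le> j" "j \<le> m" for i j
    by (rule walk_segment) (use Q(3) that in auto)
  have P0: "(P i, h1) \<in> R ^^ i" if "i \<le> m" for i
    using relpow_sym[OF sym_R segP[of 0 i]] that P(1) by simp
  have Pm: "(P i, h4) \<in> R ^^ (m - i)" if "i \<le> m" for i using segP[of i m] that P(2) by simp
  have Q0: "(h2, Q i) \<in> R ^^ i" if "i \<le> m" for i using segQ[of 0 i] that Q(1) by simp
  have Qm: "(h5, Q i) \<in> R ^^ (m - i)" if "i \<le> m" for i
    using relpow_sym[OF sym_R segQ[of i m]] that Q(2) by simp
  have e: "(h1, h2) \<in> R ^^ 1" "(h4, h5) \<in> R ^^ 1" "(h1, h5) \<in> R ^^ 2" "(h4, h2) \<in> R ^^ 2"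
    using h adj_sym by (auto simp: numeral_2_eq_2)
  note walks = relpow_trans[OF relpow_trans[OF P0 e(1)] Q0, of p q]
    relpow_trans[OF relpow_trans[OF Pm e(2)] Qm, of p' q']
    relpow_trans[OF relpow_trans[OF P0 e(3)] Qm, of p q']
    relpow_trans[OF relpow_trans[OF Pm e(4)] Q0, of p' q]
  \<comment> \<open>For each parity, two odd walks join neighbours of \<open>z\<close> on
    \<open>P\<close> to neighbours on \<open>Q\<close>, one past each end of \<open>P\<close>. Since
    \<open>p' = p + 2\<close> and \<open>q' = q + 2\<close>, they are too short together.\<close>
  show False
  proof (cases "even (p + q)")
    case True
    have "L \<le> p + 1 + q + 2"
      by (rule neighbours_parity[OF p(4) q(4)]) (use walks(1) p q True in auto)
    moreover have "L \<le> m - p' + 1 + (m - q') + 2"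
      by (rule neighbours_parity[OF p(5) q(5)]) (use walks(2) p q p' q' m \<open>even m\<close> True in auto)
    ultimately show False using p q p' q' m by linarith
  next
    case False
    have "L \<le> p + 2 + (m - q') + 2"
      by (rule neighbours_parity[OF p(4) q(5)]) (use walks(3) p q q' m \<open>even m\<close> False in auto)
    moreover have "L \<le> m - p' + 2 + q + 2"
      by (rule neighbours_parity[OF p(5) q(4)]) (use walks(4) p q p' m \<open>even m\<close> False in auto)
    ultimately show False using p q p' q' m by linarith
  qed
qed

section \<open>Tetrahedra\<close>

text \<open>
  \<open>X\<close>, \<open>Y\<close> and \<open>Z\<close> are the three faces of a subdivided \<open>K\<^sub>4\<close> at the vertex \<open>X 0 = Y 0 = Z 0\<close>. The
  leg shared by \<open>X\<close> and \<open>Y\<close> has length \<open>a\<close> and is traversed from its start by \<open>Y\<close> and backwards from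
  its end by \<open>X\<close>; likewise \<open>b\<close> for \<open>Y, Z\<close> and \<open>c\<close> for \<open>Z, X\<close>. Vertices may coincide. The positions
  in the interior of the outer edges are \<open>c < t \<le> 2k - a\<close> on \<open>X\<close>, \<open>a < t \<le> 2k - b\<close> on \<open>Y\<close>, and
  \<open>b < t \<le> 2k - c\<close> on \<open>Z\<close>. At most one leg has length \<open>1\<close>.
\<close>

definition tetrahedron where
  "tetrahedron X Y Z a b c \<longleftrightarrow>
     closed_walk X \<and> closed_walk Y \<and> closed_walk Z \<and>
     (\<forall>t\<le>a. Y t = X (L - t)) \<and> (\<forall>t\<le>b. Z t = Y (L - t)) \<and> (\<forall>t\<le>c. X t = Z (L - t)) \<and>
     1 \<le> a \<and> 1 \<le> b \<and> 1 \<le> c \<and> a + b \<le> 2 * k \<and> b + c \<le> 2 * k \<and> c + a \<le> 2 * k \<and>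
     3 \<le> a + b \<and> 3 \<le> b + c \<and> 3 \<le> c + a"

definition max_tetrahedron where
  "max_tetrahedron X Y Z a b c \<longleftrightarrow> tetrahedron X Y Z a b c \<and>
     (\<forall>X' Y' Z' a' b' c'. tetrahedron X' Y' Z' a' b' c' \<longrightarrow> a' + b' + c' \<le> a + b + c)"

section \<open>Symmetries of tetrahedra\<close>

abbreviation reversed :: "(nat \<Rightarrow> 'a) \<Rightarrow> nat \<Rightarrow> 'a" where "reversed X \<equiv> \<lambda>t. X (L - t)"

lemma tetrahedronD:
  assumes "tetrahedron X Y Z a b c"
  shows "closed_walk X" "closed_walk Y" "closed_walk Z"
    and "\<And>t. t \<le> a \<Longrightarrow> Y t = X (L - t)" "\<And>t. t \<le> b \<Longrightarrow> Z t = Y (L - t)" "\<And>t. t \<le> c \<Longrightarrow> X t = Z (L - t)"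
    and "1 \<le> a" "1 \<le> b" "1 \<le> c" "a + b \<le> 2 * k" "b + c \<le> 2 * k" "c + a \<le> 2 * k"
    and "3 \<le> a + b" "3 \<le> b + c" "3 \<le> c + a"
  using assms unfolding tetrahedron_def by blast+

lemma max_tetrahedronD:
  assumes "max_tetrahedron X Y Z a b c"
  shows "tetrahedron X Y Z a b c"
    and "tetrahedron X' Y' Z' a' b' c' \<Longrightarrow> a' + b' + c' \<le> a + b + c"
  using assms unfolding max_tetrahedron_def by blast+

lemma closed_walk_reversed:
  assumes "closed_walk X"
  shows "closed_walk (reversed X)"
  unfolding closed_walk_def
proof (intro conjI allI impI)
  fix t assume t: "t < L"
  then have "Suc (L - Suc t) = L - t" by simp
  then show "(X (L - t), X (L - Suc t)) \<in> R"
    using assms t adj_sym unfolding closed_walk_def by (metis diff_less zero_less_Suc Suc_eq_plus1)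
qed (use assms in \<open>auto simp: closed_walk_def\<close>)

lemma tetrahedron_rotate: "tetrahedron X Y Z a b c \<Longrightarrow> tetrahedron Y Z X b c a"
  unfolding tetrahedron_def by blast

text \<open>The mirror image keeps the leg \<open>b\<close> and exchanges \<open>a\<close> and
  \<open>c\<close>. With rotation, it allows each configuration to be treated for one leg and one
  orientation.\<close>

lemma tetrahedron_reflect:
  assumes T: "tetrahedron X Y Z a b c"
  shows "tetrahedron (reversed X) (reversed Z) (reversed Y) c b a"
proof -
  note T = tetrahedronD[OF T]
  have "reversed Z t = reversed X (L - t)" if "t \<le> c" for t using T(6)[of t] that T(11) by simp
  moreover have "reversed Y t = reversed Z (L - t)" if "t \<le> b" for t using T(5)[of t] that T(11) by simp
  moreover have "reversed X t = reversed Y (L - t)" if "t \<le> a" for t using T(4)[of t] that T(10) by simp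
  ultimately show ?thesis
    unfolding tetrahedron_def using closed_walk_reversed T by (auto simp: add.commute)
qed

lemma max_tetrahedron_rotate: "max_tetrahedron X Y Z a b c \<Longrightarrow> max_tetrahedron Y Z X b c a"
  unfolding max_tetrahedron_def using tetrahedron_rotate by (fastforce simp: add_ac)

lemma max_tetrahedron_reflect: "max_tetrahedron X Y Z a b c \<Longrightarrow> max_tetrahedron (reversed X) (reversed Z) (reversed Y) c b a"
  unfolding max_tetrahedron_def using tetrahedron_reflect by (fastforce simp: add_ac)

section \<open>Splicing of faces and estimates through the ends of a leg\<close>

lemma tetrahedron_origin:
  assumes "tetrahedron X Y Z a b c"
  shows "Y 0 = X 0" "Z 0 = X 0"
proof -
  note T = tetrahedronD[OF assms]
  show "Y 0 = X 0" using T(4)[of 0] T(1) by (simp add: closed_walk_def)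
  moreover have "Z 0 = Y 0" using T(5)[of 0] T(2) by (simp add: closed_walk_def)
  ultimately show "Z 0 = X 0" by simp
qed

text \<open>Both walks are indexed from the same origin, so leaving \<open>A\<close> at
  \<open>s\<close> through \<open>z\<close> and entering \<open>B\<close> at \<open>s + 2\<close>
  preserves the length \<open>L\<close>.\<close>

lemma closed_walk_splice:
  assumes "closed_walk A" "closed_walk B" "A 0 = B 0" "s + 2 \<le> L" "(z, A s) \<in> R" "(z, B (s + 2)) \<in> R"
  shows "closed_walk (\<lambda>t. if t \<le> s then A t else if t = s + 1 then z else B t)" (is "closed_walk ?C")
proof -
  have "(?C t, ?C (Suc t)) \<in> R" if t: "t < L" for t
  proof -
    consider "t < s" | "t = s" | "t = s + 1" | "s + 1 < t" by linarith
    then show ?thesis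
      by cases (use assms t adj_sym in \<open>auto simp: closed_walk_def\<close>)
  qed
  then show ?thesis using assms by (auto simp: closed_walk_def)
qed

lemma closed_walk_update:
  assumes "closed_walk X" "j + 2 \<le> L" "(z, X j) \<in> R" "(z, X (j + 2)) \<in> R"
  shows "closed_walk (X(j + 1 := z))"
proof -
  have "X(j + 1 := z) = (\<lambda>t. if t \<le> j then X t else if t = j + 1 then z else X t)" by auto
  then show ?thesis using closed_walk_splice[OF assms(1,1) _ assms(2-4)] by simp
qed

text \<open>Two ways from \<open>A i\<close> to the origin and two onwards to \<open>B j\<close>
  make four walks. In each parity case two of them are odd and are closed through
  \<open>z\<close>.\<close>

lemma origin_neighbours:
  assumes "closed_walk A" "closed_walk B" "A 0 = B 0" "i \<le> L" "j \<le> L" "(z, A i) \<in> R" "(z, B j) \<in> R"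
  shows "even (i + j) \<Longrightarrow> j \<le> i + 2 \<and> i \<le> j + 2"
    and "odd (i + j) \<Longrightarrow> L \<le> i + j + 2 \<and> i + j \<le> L + 2"
proof -
  have A: "(A i, A 0) \<in> R ^^ i" "(A i, A 0) \<in> R ^^ (L - i)"
    using closed_walk_segment(2)[OF assms(1), of 0 i] closed_walk_back(1)[OF assms(1)] assms(4) by simp_all
  have B: "(A 0, B j) \<in> R ^^ j" "(A 0, B j) \<in> R ^^ (L - j)"
    using closed_walk_segment(1)[OF assms(2), of 0 j] closed_walk_back(2)[OF assms(2)] assms(3,5) by simp_all
  note N = neighbours_parity[OF assms(6,7)]
  have o: "odd (i + (L - j)) = even (i + j)" "odd (L - i + j) = even (i + j)"
    "odd (L - i + (L - j)) = odd (i + j)"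
    using assms(4,5) by presburger+
  show "j \<le> i + 2 \<and> i \<le> j + 2" if "even (i + j)"
  proof -
    have "L \<le> i + (L - j) + 2" "L \<le> L - i + j + 2"
      by (rule N[OF relpow_trans[OF A(1) B(2)]]; use o that in simp)
         (rule N[OF relpow_trans[OF A(2) B(1)]]; use o that in simp)
    then show ?thesis using assms(4,5) by linarith
  qed
  show "L \<le> i + j + 2 \<and> i + j \<le> L + 2" if "odd (i + j)"
  proof -
    have "L \<le> i + j + 2" "L \<le> L - i + (L - j) + 2"
      by (rule N[OF relpow_trans[OF A(1) B(1)] that])
         (rule N[OF relpow_trans[OF A(2) B(2)]]; use o that in simp)
    then show ?thesis using assms(4,5) by linarith
  qed
qed

text \<open>The counterpart of \<open>origin_neighbours\<close> at the other end of the leg: the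
  walk turns at \<open>Z b\<close> instead of the origin, which saves \<open>2 * b\<close>
  edges.\<close>

lemma leg_neighbours:
  assumes "tetrahedron X Y Z a b c" "b \<le> i" "i \<le> L" "b \<le> j" "j \<le> L" "(z, Y (L - i)) \<in> R" "(z, Z j) \<in> R"
    and "odd (i + j)"
  shows "L + 2 * b \<le> i + j + 2"
proof -
  note T = tetrahedronD[OF assms(1)]
  have e: "L - b - (L - i) = i - b" using assms(2,3) by simp
  have "(Y (L - i), Z b) \<in> R ^^ (i - b)"
    using closed_walk_segment(1)[OF T(2), of "L - i" "L - b"] T(5)[of b] assms(2,3) unfolding e by simp
  moreover have "(Z b, Z j) \<in> R ^^ (j - b)"
    using closed_walk_segment(1)[OF T(3)] assms by simp
  ultimately have "(Y (L - i), Z j) \<in> R ^^ (i - b + (j - b))" by (rule relpow_trans)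
  from neighbours_parity[OF assms(6,7) this] assms(2,4,8) have "L \<le> i - b + (j - b) + 2" by auto
  then show ?thesis using assms(2,4) by linarith
qed

text \<open>The outer edges form an odd closed walk. The resulting bound serves twice: the leg sum
  attains a maximum, and there are at least \<open>4k\<close> positions to count on.\<close>

lemma outer_face:
  assumes "tetrahedron X Y Z a b c"
  shows "a + b + c \<le> L"
proof -
  note T = tetrahedronD[OF assms]
  have "(X c, Y a) \<in> R ^^ (L - a - c)" "(Y a, Z b) \<in> R ^^ (L - b - a)" "(Z b, X c) \<in> R ^^ (L - c - b)"
    using closed_walk_segment(1)[OF T(1), of c "L - a"] closed_walk_segment(1)[OF T(2), of a "L - b"]
      closed_walk_segment(1)[OF T(3), of b "L - c"] T(4)[of a] T(5)[of b] T(6)[of c] T(10-12) by simp_all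
  from relpow_trans[OF relpow_trans[OF this(1,2)] this(3)]
  have walk: "(X c, X c) \<in> R ^^ (L - a - c + (L - b - a) + (L - c - b))" .
  define x y w where "x = L - a - c" and "y = L - b - a" and "w = L - c - b"
  have d: "x + a + c = L" "y + a + b = L" "w + b + c = L" using T(10-12) by (auto simp: x_def y_def w_def)
  then have sum: "x + y + w + 2 * (a + b + c) = 6 * k + 3" by simp
  then have "odd (x + y + w)" by presburger
  then have "L \<le> x + y + w" using odd_closed walk unfolding x_def y_def w_def by blast
  then show ?thesis using sum by simp
qed

section \<open>Excluded positions of the neighbours of a vertex\<close>

text \<open>Let \<open>Z\<close> follow \<open>Y\<close> backwards up to \<open>s\<close>, pass
  through \<open>z\<close> and rejoin its old course before the leg \<open>c\<close>. The leg shared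
  with \<open>Y\<close> is then longer than \<open>b\<close>.\<close>

lemma extend_leg:
  assumes M: "max_tetrahedron X Y Z a b c" and "b < s" "s \<le> 2 * k - a" "s + 2 \<le> 2 * k - c"
    and "(z, Y (L - s)) \<in> R" "(z, Z (s + 2)) \<in> R"
  shows False
proof -
  note T = tetrahedronD[OF max_tetrahedronD(1)[OF M]]
  define Z' where "Z' t = (if t \<le> s then reversed Y t else if t = s + 1 then z else Z t)" for t
  have "closed_walk Z'" unfolding Z'_def
    by (rule closed_walk_splice[OF closed_walk_reversed[OF T(2)] T(3)])
      (use assms T(5)[of 0] in simp_all)
  moreover have "X t = Z' (L - t)" if "t \<le> c" for t
  proof -
    have "\<not> L - t \<le> s" "L - t \<noteq> s + 1" using that T(11) assms(4) by linarith+
    then show ?thesis using T(6)[OF that] by (simp add: Z'_def)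
  qed
  ultimately have "tetrahedron X Y Z' a s c"
    unfolding tetrahedron_def using T assms(2-4) by (auto simp: Z'_def)
  from max_tetrahedronD(2)[OF M this] assms(2) show False by simp
qed

lemma extend_leg_reversed:
  assumes M: "max_tetrahedron X Y Z a b c" and "b < s" "s \<le> 2 * k - c" "s + 2 \<le> 2 * k - a"
    and "(z, Z s) \<in> R" "(z, Y (L - (s + 2))) \<in> R"
  shows False
  using extend_leg[OF max_tetrahedron_reflect[OF M], of s z] assms tetrahedronD(11)[OF max_tetrahedronD(1)[OF M]] by simp

text \<open>Here \<open>s\<close> counts from the end of \<open>Y\<close>. For even
  \<open>s + t\<close> the walks through the origin force \<open>s = t\<close>, and the leg can be
  prolonged; for odd \<open>s + t\<close> the estimates at the two ends of the leg contradict each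
  other.\<close>

lemma no_two_interior_pairs:
  assumes M: "max_tetrahedron X Y Z a b c"
    and bounds: "b < s" "b < t" "s + 2 \<le> 2 * k - a" "t \<le> 2 * k - c" "t + 2 \<le> 2 * k"
    and "(z, Y (L - s)) \<in> R" "(z, Y (L - (s + 2))) \<in> R" "(z, Z t) \<in> R" "(z, Z (t + 2)) \<in> R"
  shows False
proof -
  note T = tetrahedronD[OF max_tetrahedronD(1)[OF M]]
  have YZ: "Y 0 = Z 0" using tetrahedron_origin[OF max_tetrahedronD(1)[OF M]] by simp
  have s: "s + 2 \<le> 2 * k" using bounds by simp
  show False
  proof (cases "even (s + t)")
    case True
    have o: "odd (L - s + (t + 2))" "odd (L - (s + 2) + t)" using True s by simp_all
    have "L - s + (t + 2) \<le> L + 2" "L \<le> L - (s + 2) + t + 2"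
      using origin_neighbours(2)[OF T(2,3) YZ _ _ assms(7,10) o(1)]
        origin_neighbours(2)[OF T(2,3) YZ _ _ assms(8,9) o(2)] bounds by auto
    then have "s = t" using s by linarith
    with extend_leg_reversed[OF M, of s z] bounds assms(8,9) show False by simp
  next
    case False
    have "L + 2 * b \<le> s + t + 2"
      by (rule leg_neighbours[OF max_tetrahedronD(1)[OF M]]) (use False assms in auto)
    moreover have "t + 2 \<le> L - (s + 2) + 2"
      using origin_neighbours(1)[OF T(2,3) YZ _ _ assms(8,10)] False bounds s by auto
    ultimately show False using T(8) s by linarith
  qed
qed

text \<open>On each face the outer neighbour is two steps from the origin, so one of its legs has
  length 1. Serving all three faces takes two such legs.\<close>

lemma no_origin_neighbour:
  assumes "tetrahedron X Y Z a b c" "(z, X 0) \<in> R"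
    and "c < r" "r \<le> 2 * k - a" "(z, X r) \<in> R"
    and "a < u" "u \<le> 2 * k - b" "(z, Y u) \<in> R"
    and "b < t" "t \<le> 2 * k - c" "(z, Z t) \<in> R"
  shows False
proof -
  note T = tetrahedronD[OF assms(1)] and o = tetrahedron_origin[OF assms(1)]
  have "r = 0 + 2 \<or> r + 1 = 0 + 2 * k"
    by (rule closed_walk_neighbours[OF T(1) _ _ assms(2,5)]) (use assms in auto)
  moreover have "u = 0 + 2 \<or> u + 1 = 0 + 2 * k"
    by (rule closed_walk_neighbours[OF T(2) _ _ _ assms(8)]) (use assms o in auto)
  moreover have "t = 0 + 2 \<or> t + 1 = 0 + 2 * k"
    by (rule closed_walk_neighbours[OF T(3) _ _ _ assms(11)]) (use assms o in auto)
  ultimately have "c \<le> 1 \<or> a \<le> 1" "a \<le> 1 \<or> b \<le> 1" "b \<le> 1 \<or> c \<le> 1" using assms by linarith+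
  then show False using T(13-15) by linarith
qed

text \<open>The neighbours on the two legs are two steps apart on \<open>Y\<close>. If these steps
  avoid the origin, the walk around the end of the leg \<open>c\<close> is too short; otherwise
  \<open>p = q = 1\<close>, and a hexagon with exactly one long diagonal arises.\<close>

lemma no_neighbours_on_two_legs:
  assumes Tet: "tetrahedron X Y Z a b c"
    and p: "1 \<le> p" "p \<le> a" "(z, Y p) \<in> R" and q: "1 \<le> q" "q \<le> b" "(z, Y (L - q)) \<in> R"
    and r: "c < r" "r \<le> 2 * k - a" "(z, X r) \<in> R"
    and t: "b < t" "t \<le> 2 * k - c" "(z, Z t) \<in> R"
  shows False
proof -
  note T = tetrahedronD[OF Tet] and o = tetrahedron_origin[OF Tet]
  have Xp: "(z, X (L - p)) \<in> R" using p T(4)[of p] by simp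
  have Zq: "(z, Z q) \<in> R" using q T(5)[of q] by simp
  have "L - p = r + 2 \<or> L - p + 1 = r + 2 * k"
    by (rule closed_walk_neighbours[OF T(1) _ _ r(3) Xp]) (use p r in auto)
  then have rp: "r + p + 2 = L" using p r T(7,9) by linarith
  have "t = q + 2 \<or> t + 1 = q + 2 * k"
    by (rule closed_walk_neighbours[OF T(3) _ _ Zq t(3)]) (use q t in auto)
  then have tq: "t = q + 2" using q t T(8,9) by linarith
  have "L - q = p + 2 \<or> L - q + 1 = p + 2 * k"
    by (rule closed_walk_neighbours[OF T(2) _ _ p(3) q(3)]) (use p q T(10) in auto)
  then consider "p + q + 2 = L" | "p = 1" "q = 1" using p q T(10) by linarith
  then show False
  proof cases
    case 1
    have "L + 2 * c \<le> (L - t) + r + 2"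
    proof (rule leg_neighbours[OF tetrahedron_rotate[OF Tet]])
      show "odd (L - t + r)" using 1 rp tq by presburger
    qed (use r t rp T(9,11,12) in auto)
    then show False using 1 rp tq t T(9) by linarith
  next
    case 2
    have "r = 2 * k - 2" "t = 3" using rp tq 2 by linarith+
    with r(3) t(3) have r: "(z, X (2 * k - 2)) \<in> R" and t: "(z, Z 3) \<in> R" by simp_all
    have step: "(F i, F j) \<in> R" if "closed_walk F" "i < L" "j = Suc i" for F i j
      using that by (auto simp: closed_walk_def)
    have L: "F (2 * k + 1) = F 0" if "closed_walk F" for F using that by (simp add: closed_walk_def)
    have Y1: "Y 1 = X (2 * k)" using T(4)[of 1] T(7) by simp
    have Z1: "Z 1 = Y (2 * k)" using T(5)[of 1] T(8) by simp
    have zY: "(z, Y 1) \<in> R" "(z, Y (2 * k)) \<in> R" using p q 2 by simp_all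
    have "(X (2 * k), X (2 * k + 1)) \<in> R" "(Z 0, Z 1) \<in> R"
      by (rule step[OF T(1)]; simp) (rule step[OF T(3)]; simp)
    then have e: "(Y 1, X 0) \<in> R" "(X 0, Y (2 * k)) \<in> R"
      by (simp_all only: Y1 Z1 L[OF T(1)] o)
    show False
    \<comment> \<open>One of the legs \<open>a\<close> and \<open>b\<close> has a second vertex,
      which completes the hexagon. Its other two long diagonals would be chords of faces.\<close>
    proof (cases "2 \<le> a")
      case True
      then have Y2: "Y 2 = X (2 * k - 1)" using T(4)[of 2] by simp
      have "(X (2 * k - 2), X (2 * k - 1)) \<in> R" "(X (2 * k - 1), Y 1) \<in> R"
        unfolding Y1 by (rule step[OF T(1)]; use k_ge_2 in linarith)+
      from hexagon[OF e adj_sym[OF zY(2)] r this adj_sym[OF zY(1)]]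
      have "(X 0, X (2 * k - 2)) \<in> R \<or> (Y 2, Y (2 * k)) \<in> R"
        unfolding Y2 using adj_sym by blast
      moreover have "(X 0, X (2 * k - 2)) \<notin> R"
        using closed_walk_chord[OF T(1), of 0 "2 * k - 2"] k_ge_2 by linarith
      moreover have "(Y 2, Y (2 * k)) \<notin> R"
        using closed_walk_chord[OF T(2), of 2 "2 * k"] k_ge_2 by linarith
      ultimately show False by blast
    next
      case False
      then have "2 \<le> b" using T(13) by simp
      then have Z2: "Z 2 = Y (2 * k - 1)" using T(5)[of 2] by simp
      have "(Z 3, Z 2) \<in> R" "(Z 2, Y (2 * k)) \<in> R"
        unfolding Z1[symmetric] by (rule adj_sym, rule step[OF T(3)]; use k_ge_2 in linarith)+
      from hexagon[OF adj_sym[OF e(2)] adj_sym[OF e(1)] adj_sym[OF zY(1)] t this adj_sym[OF zY(2)]]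
      have "(Z 0, Z 3) \<in> R \<or> (Y 1, Y (2 * k - 1)) \<in> R"
        unfolding Z2 using o by simp
      moreover have "(Z 0, Z 3) \<notin> R"
        using closed_walk_chord[OF T(3), of 0 3] k_ge_2 by auto
      moreover have "(Y 1, Y (2 * k - 1)) \<notin> R"
        using closed_walk_chord[OF T(2), of 1 "2 * k - 1"] k_ge_2 by linarith
      ultimately show False by blast
    qed
  qed
qed

text \<open>The estimate through the origin contradicts the one at the end of the leg
  \<open>a\<close> or \<open>c\<close>, according to parity.\<close>

lemma no_pair_on_leg:
  assumes Tet: "tetrahedron X Y Z a b c"
    and p: "1 \<le> p" "p + 2 \<le> b" "(z, Z p) \<in> R" "(z, Z (p + 2)) \<in> R"
    and t: "c < t" "t + 2 \<le> 2 * k - a" "(z, X t) \<in> R" "(z, X (t + 2)) \<in> R"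
  shows False
proof -
  note T = tetrahedronD[OF Tet]
  have ZX: "Z 0 = X 0" using tetrahedron_origin[OF Tet] by simp
  have le: "p \<le> L" "t \<le> L" "t + 2 \<le> L" "p + 2 \<le> L"
    using p t T(8,10,11) by linarith+
  have Yp: "(z, Y (L - (p + 2))) \<in> R" using p T(5)[of "p + 2"] by simp
  show False
  proof (cases "odd (p + t)")
    case True
    have "L \<le> p + t + 2"
      using origin_neighbours(2)[OF T(3,1) ZX le(1,2) p(3) t(3) True] by simp
    moreover have "L + 2 * a \<le> (L - (t + 2)) + (L - (p + 2)) + 2"
    proof (rule leg_neighbours[OF tetrahedron_rotate[OF tetrahedron_rotate[OF Tet]]])
      show "odd (L - (t + 2) + (L - (p + 2)))" using True le by simp
      show "(z, X (L - (L - (t + 2)))) \<in> R" using t le by simp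
    qed (use Yp p t T(7,10,12) in auto)
    ultimately show False using T(7) le by linarith
  next
    case False
    have "t + 2 \<le> p + 2"
      using origin_neighbours(1)[OF T(3,1) ZX le(1,3) p(3) t(4)] False by simp
    moreover have "L + 2 * c \<le> (L - (p + 2)) + t + 2"
    proof (rule leg_neighbours[OF tetrahedron_rotate[OF Tet]])
      show "odd (L - (p + 2) + t)" using False le by simp
      show "(z, Z (L - (L - (p + 2)))) \<in> R" using p le by simp
    qed (use p t T(9,11) in auto)
    ultimately show False using T(9) le by linarith
  qed
qed

text \<open>\<open>z\<close> can replace the first vertex beyond the leg end on both
  \<open>Y\<close> and \<open>Z\<close>, so the leg grows by one edge.\<close>

lemma no_neighbours_around_leg_end:
  assumes M: "max_tetrahedron X Y Z a b c"
    and "b + 3 \<le> L - a" "b + 3 \<le> L - c"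
    and z: "(z, Z b) \<in> R" "(z, Y (L - (b + 2))) \<in> R" "(z, Z (b + 2)) \<in> R"
  shows False
proof -
  note T = tetrahedronD[OF max_tetrahedronD(1)[OF M]]
  let ?Y = "Y(L - (b + 1) := z)" and ?Z = "Z(b + 1 := z)"
  have e: "L - (b + 2) + 2 = L - b" "L - (b + 2) + 1 = L - (b + 1)" using T(11) assms(3) by linarith+
  have "closed_walk ?Y"
    using closed_walk_update[OF T(2), of "L - (b + 2)" z] z T(5)[of b] unfolding e by simp
  moreover have "closed_walk ?Z"
    by (rule closed_walk_update[OF T(3)]) (use assms in auto)
  moreover have "?Y t = X (L - t)" if "t \<le> a" for t
    using T(4)[OF that] that assms(2) e by auto
  moreover have "?Z t = ?Y (L - t)" if "t \<le> b + 1" for t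
  proof (cases "t = b + 1")
    case False
    then have "L - t \<noteq> L - (b + 1)" using that assms(2) by linarith
    then show ?thesis using False that T(5)[of t] by simp
  qed simp
  moreover have "X t = ?Z (L - t)" if "t \<le> c" for t
  proof -
    have "L - t \<noteq> b + 1" using that assms(3) by linarith
    then show ?thesis using T(6)[OF that] by simp
  qed
  ultimately have "tetrahedron X ?Y ?Z a (b + 1) c"
    unfolding tetrahedron_def using T assms(2,3) by auto
  from max_tetrahedronD(2)[OF M this] show False by simp
qed

text \<open>\<open>z\<close> can take the place of the leg end. The estimates at the origin and at
  the end of the leg \<open>a\<close> leave only \<open>a = 1\<close> and \<open>b + t = 2k\<close>,
  where rerouting increases the leg sum.\<close>

lemma no_neighbours_before_leg_end_even:
  assumes M: "max_tetrahedron X Y Z a b c"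
    and b: "2 \<le> b" and z: "(z, Z (b - 1)) \<in> R" "(z, Z (b + 1)) \<in> R" "(z, Y (L - (b + 1))) \<in> R"
    and t: "c < t" "t \<le> 2 * k - a" "(z, X t) \<in> R" and ev: "even (b + t)"
  shows False
proof -
  note T = tetrahedronD[OF max_tetrahedronD(1)[OF M]]
  have ZX: "Z 0 = X 0" using tetrahedron_origin[OF max_tetrahedronD(1)[OF M]] by simp
  have le: "b - 1 \<le> L" "t \<le> L" "b + 1 \<le> L" using T(10,11) t by linarith+
  have o: "odd (b - 1 + t)" using b ev by simp
  have bt: "2 * k \<le> b + t"
    using origin_neighbours(2)[OF T(3,1) ZX le(1,2) z(1) t(3) o] b by simp
  have "L + 2 * a \<le> (L - t) + (L - (b + 1)) + 2"
  proof (rule leg_neighbours[OF tetrahedron_rotate[OF tetrahedron_rotate[OF max_tetrahedronD(1)[OF M]]]])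
    show "odd (L - t + (L - (b + 1)))" using ev le by simp
    show "(z, X (L - (L - t))) \<in> R" using t le by simp
  qed (use z t T(7,10,12) in auto)
  then have "b + t + 2 * a \<le> 2 * k + 2" using le by linarith
  with bt T(7) have a: "a = 1" and bt: "b + t = 2 * k" by linarith+
  \<comment> \<open>Reroute \<open>Z\<close>: along its leg to \<open>z\<close>, then back along \<open>X\<close>. It now shares \<open>t > c\<close> edges with \<open>X\<close>.\<close>
  let ?Y = "Y(L - b := z)"
  define D where "D s = (if s \<le> b - 1 then Z s else if s = b - 1 + 1 then z else reversed X s)" for s
  have e: "L - (b + 1) + 2 = L - (b - 1)" "L - (b + 1) + 1 = L - b" "L - (b + 1) = t" "b - 1 + 1 = b" "b - 1 + 2 = b + 1"
    using b bt by linarith+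
  have Yb: "Y (L - (b - 1)) = Z (b - 1)" using T(5)[of "b - 1"] by simp
  have "closed_walk ?Y"
    using closed_walk_update[OF T(2), of "L - (b + 1)" z] z Yb unfolding e(1,2) by simp
  moreover have "closed_walk D"
    unfolding D_def
  proof (rule closed_walk_splice[OF T(3) closed_walk_reversed[OF T(1)] _ _ z(1)])
    show "(z, X (L - (b - 1 + 2))) \<in> R" using t(3) e by simp
    show "Z 0 = X (L - 0)" using ZX T(1) by (simp add: closed_walk_def)
  qed (use e le in linarith)
  moreover have "?Y s = X (L - s)" if "s \<le> 1" for s
  proof -
    have "s \<noteq> L - b" using that T(10) a by linarith
    then show ?thesis using T(4)[of s] that a e by simp
  qed
  moreover have "D s = ?Y (L - s)" if "s \<le> b" for s
  proof (cases "s = b")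
    case False
    then have "s \<le> b - 1" "L - s \<noteq> L - b" using that le by linarith+
    then show ?thesis using T(5)[of s] that unfolding D_def e by simp
  next
    case True
    have "\<not> b \<le> b - 1" using b by linarith
    then show ?thesis unfolding True D_def e(4) by simp
  qed
  moreover have "X s = D (L - s)" if "s \<le> t" for s
  proof -
    have "\<not> L - s \<le> b - 1" "L - s \<noteq> b - 1 + 1" "L - (L - s) = s" using that bt b by linarith+
    then show ?thesis by (simp add: D_def)
  qed
  moreover have "2 \<le> t" using t T(9) by linarith
  ultimately have "tetrahedron X ?Y D 1 b t"
    unfolding tetrahedron_def using T b bt by auto
  from max_tetrahedronD(2)[OF M this] show False using a t by simp
qed

text \<open>Reflection replaces \<open>t\<close> by \<open>L - t\<close> and so switches the
  parity.\<close>

lemma no_neighbours_before_leg_end: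
  assumes M: "max_tetrahedron X Y Z a b c"
    and b: "2 \<le> b" and z: "(z, Z (b - 1)) \<in> R" "(z, Z (b + 1)) \<in> R" "(z, Y (L - (b + 1))) \<in> R"
    and t: "c < t" "t \<le> 2 * k - a" "(z, X t) \<in> R"
  shows False
proof (cases "even (b + t)")
  case False
  note T = tetrahedronD[OF max_tetrahedronD(1)[OF M]]
  have le: "t \<le> L" "b + 1 \<le> L" using t T(10) by linarith+
  show False
  proof (rule no_neighbours_before_leg_end_even[OF max_tetrahedron_reflect[OF M] b, of z "L - t"])
    have "Y (L - (b - 1)) = Z (b - 1)" using T(5)[of "b - 1"] by simp
    then show "(z, Y (L - (b - 1))) \<in> R" using z by simp
    show "even (b + (L - t))" using False le by simp
    show "a < L - t" "L - t \<le> 2 * k - c" using t T(12) by linarith+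
  qed (use z t le in simp_all)
qed (use no_neighbours_before_leg_end_even[OF assms] in blast)

text \<open>The neighbour on the leg is position \<open>u + 2\<close> of \<open>Y\<close>. It forms
  a pair with \<open>u\<close>, and \<open>no_two_interior_pairs\<close> lets the second member of
  such a pair lie on a leg.\<close>

lemma no_leg_neighbour_and_interior_pair:
  assumes M: "max_tetrahedron X Y Z a b c"
    and m: "1 \<le> m" "m \<le> b" "(z, Y (L - m)) \<in> R"
    and u: "a < u" "u \<le> 2 * k - b" "(z, Y u) \<in> R" "u + 2 + m = L"
    and r: "c < r" "r + 2 \<le> 2 * k - a" "(z, X r) \<in> R" "(z, X (r + 2)) \<in> R"
  shows False
proof (rule no_two_interior_pairs[OF max_tetrahedron_rotate[OF max_tetrahedron_rotate[OF M]], of "L - (r + 2)" u z])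
  note T = tetrahedronD[OF max_tetrahedronD(1)[OF M]]
  have e: "L - (L - (r + 2)) = r + 2" "L - (r + 2) + 2 = L - r" "L - (L - r) = r" "L - m = u + 2"
    using u r by linarith+
  show "(z, X (L - (L - (r + 2)))) \<in> R" "(z, X (L - (L - (r + 2) + 2))) \<in> R"
    using r by (simp_all only: e)
  show "(z, Y (u + 2)) \<in> R" using m(3) by (simp only: e)
  show "a < L - (r + 2)" "L - (r + 2) + 2 \<le> 2 * k - c" "u + 2 \<le> 2 * k" using r u m T(7,12) by linarith+
qed (use u in simp_all)

text \<open>
  The parity where \<open>t\<close> would differ from \<open>u + 2\<close> always allows the leg between \<open>Y\<close> and \<open>Z\<close> to be
  prolonged along one face up to \<open>z\<close> and to return to the other.
\<close>

lemma chord_position: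
  assumes M: "max_tetrahedron X Y Z a b c"
    and u: "a < u" "u + 2 \<le> 2 * k - b" "(z, Y u) \<in> R" "(z, Y (u + 2)) \<in> R"
    and t: "b < t" "t \<le> 2 * k - c" "(z, Z t) \<in> R"
  shows "t = u + 2"
proof -
  note T = tetrahedronD[OF max_tetrahedronD(1)[OF M]]
  have YZ: "Y 0 = Z 0" using tetrahedron_origin[OF max_tetrahedronD(1)[OF M]] by simp
  have le: "u \<le> L" "u + 2 \<le> L" "t \<le> L" using u t T(10) by linarith+
  show ?thesis
  proof (cases "even (u + t)")
    case True
    have "t \<le> u + 2" using origin_neighbours(1)[OF T(2,3) YZ le(1,3) u(3) t(3)] True by simp
    moreover have "L + 2 * b \<le> L - (u + 2) + t + 2"
    proof (rule leg_neighbours[OF max_tetrahedronD(1)[OF M]])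
      show "odd (L - (u + 2) + t)" using True le by simp
      show "(z, Y (L - (L - (u + 2)))) \<in> R" using u le by simp
    qed (use u t T(10,11) in auto)
    ultimately show ?thesis using T(8) le by linarith
  next
    case False
    have "u + 2 + t \<le> L + 2" "L \<le> u + t + 2"
      using origin_neighbours(2)[OF T(2,3) YZ le(2,3) u(4) t(3)]
        origin_neighbours(2)[OF T(2,3) YZ le(1,3) u(3) t(3)] False by simp_all
    moreover have "u + t \<noteq> 2 * k" using False by presburger
    ultimately consider "u + t = L" | "u + t + 2 = L" by linarith
    then show ?thesis
    proof cases
      case 1
      have e: "L - (t - 2) = u + 2" "t - 2 + 2 = t" using 1 u(2) t(1) T(8) by linarith+
      have False
      proof (rule extend_leg[OF M, of "t - 2" z])
        show "b < t - 2" "t - 2 \<le> 2 * k - a" "t - 2 + 2 \<le> 2 * k - c"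
          using 1 u(1,2) t(1,2) T(7,8,10) by linarith+
      qed (use u(4) t(3) in \<open>simp_all only: e\<close>)
      then show ?thesis ..
    next
      case 2
      have e: "L - (t + 2) = u" using 2 by linarith
      have False
      proof (rule extend_leg_reversed[OF M, of t z])
        show "t + 2 \<le> 2 * k - a" using 2 u(1) T(10) by linarith
      qed (use u(3) t in \<open>simp_all only: e\<close>)
      then show ?thesis ..
    qed
  qed
qed

text \<open>\<open>chord_position\<close> and its mirror image give \<open>t = u + 2\<close> and
  \<open>r = u\<close>; then the odd walk through \<open>z\<close> around the end of the leg
  \<open>c\<close> is too short.\<close>

lemma no_interior_pair_and_singles:
  assumes M: "max_tetrahedron X Y Z a b c"
    and u: "a < u" "u + 2 \<le> 2 * k - b" "(z, Y u) \<in> R" "(z, Y (u + 2)) \<in> R"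
    and t: "b < t" "t \<le> 2 * k - c" "(z, Z t) \<in> R"
    and r: "c < r" "r \<le> 2 * k - a" "(z, X r) \<in> R"
  shows False
proof -
  note T = tetrahedronD[OF max_tetrahedronD(1)[OF M]]
  have tu: "t = u + 2" by (rule chord_position[OF M u t])
  have "L - r = L - (u + 2) + 2"
  proof (rule chord_position[OF max_tetrahedron_rotate[OF max_tetrahedron_reflect[OF M]]])
    have "L - (L - (u + 2)) = u + 2" "L - (L - (u + 2) + 2) = u" "L - (L - r) = r"
      using u r by linarith+
    then show "(z, Y (L - (L - (u + 2)))) \<in> R" "(z, Y (L - (L - (u + 2) + 2))) \<in> R"
      "(z, X (L - (L - r))) \<in> R" using u r by simp_all
  qed (use u r T(10,12) in linarith)+
  then have ru: "r = u" using u r T(7) by linarith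
  have "L + 2 * c \<le> L - t + r + 2"
  proof (rule leg_neighbours[OF tetrahedron_rotate[OF max_tetrahedronD(1)[OF M]]])
    show "odd (L - t + r)" using tu ru u by simp
    show "(z, Z (L - (L - t))) \<in> R" using t by simp
  qed (use r t T(11,12) in auto)
  then show False using tu ru T(9) u by linarith
qed

section \<open>Distribution of four neighbours over a tetrahedron\<close>

text \<open>With half-open ranges the origin, the two legs and the outer edge partition a face; a
  leg includes its far end but not the origin.\<close>

definition neighbours where
  "neighbours z X i j = {t::nat. i < t \<and> t \<le> j \<and> (z, X t) \<in> R}"

lemma neighbours_obtain:
  assumes "1 \<le> card (neighbours z X i j)"
  obtains t where "i < t" "t \<le> j" "(z, X t) \<in> R"
proof -
  have "neighbours z X i j \<noteq> {}" using assms by auto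
  then show thesis using that by (auto simp: neighbours_def)
qed

lemma neighbours_pair_obtain:
  assumes "closed_walk X" "j < 2 * k" "2 \<le> card (neighbours z X i j)"
  obtains t where "i < t" "t + 2 \<le> j" "(z, X t) \<in> R" "(z, X (t + 2)) \<in> R"
proof -
  obtain s t where st: "s \<in> neighbours z X i j" "t \<in> neighbours z X i j" "s < t"
    by (rule two_elements[OF assms(3)])
  then have "t = s + 2 \<or> t + 1 = s + 2 * k"
    by (intro closed_walk_neighbours[OF assms(1)]) (use assms(2) in \<open>auto simp: neighbours_def\<close>)
  then have "t = s + 2" using st assms(2) by (auto simp: neighbours_def)
  then show thesis using that[of s] st by (auto simp: neighbours_def)
qed

lemma face_card:
  assumes "closed_walk X" "i \<le> j" "j \<le> 2 * k"
  shows "of_bool ((z, X 0) \<in> R) + card (neighbours z X 0 i) + card (neighbours z X i j)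
    + card (neighbours z X j (2 * k)) \<le> 2"
proof -
  have fin: "finite (neighbours z X i' j')" for i' j' by (simp add: neighbours_def)
  have "{t. t \<le> 2 * k \<and> (z, X t) \<in> R} =
      {t. t = 0 \<and> (z, X 0) \<in> R} \<union> neighbours z X 0 i \<union> neighbours z X i j \<union> neighbours z X j (2 * k)"
    using assms by (auto simp: neighbours_def intro: gr0I)
  also have "card \<dots> = card {t::nat. t = 0 \<and> (z, X 0) \<in> R} + card (neighbours z X 0 i)
      + card (neighbours z X i j) + card (neighbours z X j (2 * k))"
    using fin assms by (subst card_Un_disjoint; (auto simp: neighbours_def)?)+
  finally show ?thesis using card_closed_walk_neighbours[OF assms(1), of z] by (auto split: if_splits)
qed

lemma leg_card:
  assumes "\<And>t. t \<le> a \<Longrightarrow> Y t = X (L - t)" "a \<le> 2 * k"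
  shows "card (neighbours z X (2 * k - a) (2 * k)) = card (neighbours z Y 0 a)"
proof (rule bij_betw_same_card)
  have *: "Y (L - t) = X t" if "2 * k - a < t" "t \<le> 2 * k" for t
  proof -
    have "L - t \<le> a" "L - (L - t) = t" using that assms(2) by linarith+
    then show ?thesis using assms(1)[of "L - t"] by simp
  qed
  show "bij_betw (\<lambda>t. L - t) (neighbours z X (2 * k - a) (2 * k)) (neighbours z Y 0 a)"
    by (rule bij_betw_byWitness[where f' = "\<lambda>t. L - t"])
      (use assms * in \<open>auto simp: neighbours_def\<close>)
qed

lemma tetrahedron_faces:
  assumes "tetrahedron X Y Z a b c"
  shows "of_bool ((z, X 0) \<in> R) + card (neighbours z X 0 c) + card (neighbours z X c (2 * k - a)) + card (neighbours z Y 0 a) \<le> 2"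
    and "of_bool ((z, X 0) \<in> R) + card (neighbours z Y 0 a) + card (neighbours z Y a (2 * k - b)) + card (neighbours z Z 0 b) \<le> 2"
    and "of_bool ((z, X 0) \<in> R) + card (neighbours z Z 0 b) + card (neighbours z Z b (2 * k - c)) + card (neighbours z X 0 c) \<le> 2"
proof -
  note T = tetrahedronD[OF assms(1)]
  note l = leg_card[of a Y X z, OF T(4)] leg_card[of b Z Y z, OF T(5)] leg_card[of c X Z z, OF T(6)]
  show "of_bool ((z, X 0) \<in> R) + card (neighbours z X 0 c) + card (neighbours z X c (2 * k - a)) + card (neighbours z Y 0 a) \<le> 2"
    using face_card[OF T(1), of c "2 * k - a" z] l(1) T(10-12) by simp
  show "of_bool ((z, X 0) \<in> R) + card (neighbours z Y 0 a) + card (neighbours z Y a (2 * k - b)) + card (neighbours z Z 0 b) \<le> 2"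
    using face_card[OF T(2), of a "2 * k - b" z] l(2) T(10-12) tetrahedron_origin[OF assms(1)] by simp
  show "of_bool ((z, X 0) \<in> R) + card (neighbours z Z 0 b) + card (neighbours z Z b (2 * k - c)) + card (neighbours z X 0 c) \<le> 2"
    using face_card[OF T(3), of b "2 * k - c" z] l(3) T(10-12) tetrahedron_origin[OF assms(1)] by simp
qed

text \<open>A neighbour on a second leg fills the face between the two legs, so the other two faces
  each have an outer neighbour. Without one, outer neighbours on \<open>Y\<close> and
  \<open>Z\<close> have positions determined by \<open>m\<close>.\<close>

lemma no_leg_neighbour:
  assumes M: "max_tetrahedron X Y Z a b c" and o: "(z, X 0) \<notin> R"
    and sum: "4 \<le> card (neighbours z X 0 c) + card (neighbours z X c (2 * k - a))
      + card (neighbours z Y 0 a) + card (neighbours z Y a (2 * k - b))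
      + card (neighbours z Z 0 b) + card (neighbours z Z b (2 * k - c))"
    and lb: "1 \<le> card (neighbours z Z 0 b)"
  shows False
proof -
  note Tet = max_tetrahedronD(1)[OF M]
  note T = tetrahedronD[OF Tet]
  note F = tetrahedron_faces[OF Tet, of z]
  obtain m where m: "0 < m" "m \<le> b" "(z, Z m) \<in> R" by (rule neighbours_obtain[OF lb])
  have Ym: "(z, Y (L - m)) \<in> R" using m T(5)[of m] by simp
  consider (a) "1 \<le> card (neighbours z Y 0 a)" | (c) "1 \<le> card (neighbours z X 0 c)"
    | (none) "card (neighbours z Y 0 a) = 0" "card (neighbours z X 0 c) = 0" by linarith
  then show False
  proof cases
    case a
    then have "1 \<le> card (neighbours z X c (2 * k - a))" "1 \<le> card (neighbours z Z b (2 * k - c))"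
      using F sum lb by linarith+
    then obtain p r t where "0 < p" "p \<le> a" "(z, Y p) \<in> R" "c < r" "r \<le> 2 * k - a" "(z, X r) \<in> R"
      "b < t" "t \<le> 2 * k - c" "(z, Z t) \<in> R"
      using neighbours_obtain a by metis
    with no_neighbours_on_two_legs[OF Tet, of p z m r t] m Ym show False by simp
  next
    case c
    then have "1 \<le> card (neighbours z X c (2 * k - a))" "1 \<le> card (neighbours z Y a (2 * k - b))"
      using F sum lb by linarith+
    then obtain q r t where q: "0 < q" "q \<le> c" "(z, X q) \<in> R" and "a < r" "r \<le> 2 * k - b" "(z, Y r) \<in> R"
      "c < t" "t \<le> 2 * k - a" "(z, X t) \<in> R"
      using neighbours_obtain c by metis
    moreover have "(z, Z (L - q)) \<in> R" using q T(6)[of q] by simp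
    ultimately show False using no_neighbours_on_two_legs[OF tetrahedron_rotate[OF Tet], of m z q r t] m by simp
  next
    case none
    have u_pos: "u + 2 + m = L" if "a < u" "u \<le> 2 * k - b" "(z, Y u) \<in> R" for u
    proof -
      have "L - m = u + 2 \<or> L - m + 1 = u + 2 * k"
        by (rule closed_walk_neighbours[OF T(2) _ _ that(3) Ym]) (use that m T(10) in linarith)+
      then show ?thesis using that m T(7,10) by linarith
    qed
    have t_pos: "t = m + 2" if "b < t" "t \<le> 2 * k - c" "(z, Z t) \<in> R" for t
    proof -
      have "t = m + 2 \<or> t + 1 = m + 2 * k"
        by (rule closed_walk_neighbours[OF T(3) _ _ m(3) that(3)]) (use that m in linarith)+
      then show ?thesis using that m T(9) by linarith
    qed
    have x: "card (neighbours z X c (2 * k - a)) \<le> 2"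
      and y: "card (neighbours z Z 0 b) + card (neighbours z Y a (2 * k - b)) \<le> 2"
      and w: "card (neighbours z Z 0 b) + card (neighbours z Z b (2 * k - c)) \<le> 2"
      and s: "4 \<le> card (neighbours z X c (2 * k - a)) + card (neighbours z Y a (2 * k - b))
        + card (neighbours z Z 0 b) + card (neighbours z Z b (2 * k - c))"
      using F sum none by linarith+
    consider (two) "2 \<le> card (neighbours z Z 0 b)" "2 \<le> card (neighbours z X c (2 * k - a))"
      | (Y) "2 \<le> card (neighbours z X c (2 * k - a))" "1 \<le> card (neighbours z Y a (2 * k - b))"
      | (Z) "2 \<le> card (neighbours z X c (2 * k - a))" "1 \<le> card (neighbours z Z b (2 * k - c))"
      | (all) "1 \<le> card (neighbours z X c (2 * k - a))" "1 \<le> card (neighbours z Y a (2 * k - b))"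
        "1 \<le> card (neighbours z Z b (2 * k - c))"
      using x y w s lb by linarith
    then show False
    proof cases
      case two
      obtain p where p: "0 < p" "p + 2 \<le> b" "(z, Z p) \<in> R" "(z, Z (p + 2)) \<in> R"
        by (rule neighbours_pair_obtain[OF T(3) _ two(1)]) (use T(9,11) in linarith)+
      obtain r where "c < r" "r + 2 \<le> 2 * k - a" "(z, X r) \<in> R" "(z, X (r + 2)) \<in> R"
        by (rule neighbours_pair_obtain[OF T(1) _ two(2)]) (use T(7) k_ge_2 in linarith)+
      then show False using no_pair_on_leg[OF Tet, of p z r] p by simp
    next
      case Y
      obtain r where r: "c < r" "r + 2 \<le> 2 * k - a" "(z, X r) \<in> R" "(z, X (r + 2)) \<in> R"
        by (rule neighbours_pair_obtain[OF T(1) _ Y(1)]) (use T(7) k_ge_2 in linarith)+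
      obtain u where u: "a < u" "u \<le> 2 * k - b" "(z, Y u) \<in> R" by (rule neighbours_obtain[OF Y(2)])
      show False by (rule no_leg_neighbour_and_interior_pair[OF M _ m(2) Ym u u_pos[OF u] r]) (use m in simp)
    next
      case Z
      obtain r where r: "c < r" "r + 2 \<le> 2 * k - a" "(z, X r) \<in> R" "(z, X (r + 2)) \<in> R"
        by (rule neighbours_pair_obtain[OF T(1) _ Z(1)]) (use T(7) k_ge_2 in linarith)+
      obtain t where t: "b < t" "t \<le> 2 * k - c" "(z, Z t) \<in> R" by (rule neighbours_obtain[OF Z(2)])
      have e: "L - (L - m) = m" "L - (L - t) = t" "L - (L - (r + 2)) = r + 2" "L - (L - (r + 2) + 2) = r"
        using m T(10) t r by linarith+
      show False
      proof (rule no_leg_neighbour_and_interior_pair[OF max_tetrahedron_reflect[OF M], of m z "L - t" "L - (r + 2)"])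
        show "c < L - t" "L - t \<le> 2 * k - b" using t T(11) by linarith+
        show "a < L - (r + 2)" "L - (r + 2) + 2 \<le> 2 * k - c" using r T(12) by linarith+
        show "L - t + 2 + m = L" using t_pos[OF t] t by linarith
      qed (use m t r in \<open>simp_all only: e\<close>)
    next
      case all
      obtain r where r: "c < r" "r \<le> 2 * k - a" "(z, X r) \<in> R" by (rule neighbours_obtain[OF all(1)])
      obtain u where u: "a < u" "u \<le> 2 * k - b" "(z, Y u) \<in> R" by (rule neighbours_obtain[OF all(2)])
      obtain t where t: "b < t" "t \<le> 2 * k - c" "(z, Z t) \<in> R" by (rule neighbours_obtain[OF all(3)])
      note um = u_pos[OF u] and tm = t_pos[OF t]
      \<comment> \<open>The neighbour at \<open>m + 2\<close> already lies beyond the leg.\<close>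
      have "m = b \<or> m + 1 = b" using tm t m by linarith
      then show False
      proof
        assume mb: "m = b"
        have e: "L - (b + 2) = u" "b + 2 = t" using um tm mb by linarith+
        show False
        proof (rule no_neighbours_around_leg_end[OF M, of z])
          show "b + 3 \<le> L - a" "b + 3 \<le> L - c" using e u t T(10,11) by linarith+
          show "(z, Z b) \<in> R" using m mb by simp
          show "(z, Y (L - (b + 2))) \<in> R" unfolding e(1) by (rule u(3))
          show "(z, Z (b + 2)) \<in> R" unfolding e(2) by (rule t(3))
        qed
      next
        assume mb: "m + 1 = b"
        have e: "b - 1 = m" "b + 1 = t" "L - (b + 1) = u" using um tm mb by linarith+
        show False
        proof (rule no_neighbours_before_leg_end[OF M _ _ _ _ r])
          show "(z, Z (b - 1)) \<in> R" unfolding e(1) by (rule m(3))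
          show "(z, Z (b + 1)) \<in> R" unfolding e(2) by (rule t(3))
          show "(z, Y (L - (b + 1))) \<in> R" unfolding e(3) by (rule u(3))
          show "2 \<le> b" using m mb by linarith
        qed
      qed
    qed
  qed
qed

lemma no_interior_neighbours:
  assumes M: "max_tetrahedron X Y Z a b c"
    and two: "2 \<le> card (neighbours z Y a (2 * k - b))"
    and rest: "2 \<le> card (neighbours z Z b (2 * k - c)) \<or>
      1 \<le> card (neighbours z Z b (2 * k - c)) \<and> 1 \<le> card (neighbours z X c (2 * k - a))"
  shows False
proof -
  note T = tetrahedronD[OF max_tetrahedronD(1)[OF M]]
  obtain u where u: "a < u" "u + 2 \<le> 2 * k - b" "(z, Y u) \<in> R" "(z, Y (u + 2)) \<in> R"
    by (rule neighbours_pair_obtain[OF T(2) _ two]) (use T(8) k_ge_2 in linarith)+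
  from rest show False
  proof
    assume zz: "2 \<le> card (neighbours z Z b (2 * k - c))"
    obtain t where t: "b < t" "t + 2 \<le> 2 * k - c" "(z, Z t) \<in> R" "(z, Z (t + 2)) \<in> R"
      by (rule neighbours_pair_obtain[OF T(3) _ zz]) (use T(9) k_ge_2 in linarith)+
    have e: "L - (L - (u + 2)) = u + 2" "L - (L - (u + 2) + 2) = u" using u by linarith+
    show False
    proof (rule no_two_interior_pairs[OF M, of "L - (u + 2)" t z])
      show "b < L - (u + 2)" "L - (u + 2) + 2 \<le> 2 * k - a" "t \<le> 2 * k - c" "t + 2 \<le> 2 * k"
        using u t T(10) by linarith+
    qed (use u t in \<open>simp_all only: e\<close>)
  next
    assume "1 \<le> card (neighbours z Z b (2 * k - c)) \<and> 1 \<le> card (neighbours z X c (2 * k - a))"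
    then obtain t r where "b < t" "t \<le> 2 * k - c" "(z, Z t) \<in> R" "c < r" "r \<le> 2 * k - a" "(z, X r) \<in> R"
      using neighbours_obtain by metis
    then show False using no_interior_pair_and_singles[OF M u] by blast
  qed
qed

text \<open>For a vertex \<open>z\<close> with four neighbours, first the origin, then the legs are
  ruled out as places of neighbours. The outer edges alone cannot hold four.\<close>

lemma no_max_tetrahedron: "\<not> max_tetrahedron X Y Z a b c"
proof
  assume M: "max_tetrahedron X Y Z a b c"
  note Tet = max_tetrahedronD(1)[OF M]
  note T = tetrahedronD[OF Tet]
  have V: "F ` S \<subseteq> V" if F: "closed_walk F" and S: "S \<subseteq> {..2 * k}" for F S
  proof
    fix v assume "v \<in> F ` S"
    then obtain t where "v = F t" "t < L" using S by fastforce
    then show "v \<in> V" using F adj_V(1) unfolding closed_walk_def by blast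
  qed
  \<comment> \<open>Each range omits the last leg of its face and only the first contains
    \<open>0\<close>, so the origin and every leg are counted once.\<close>
  have "card {..2 * k - a} + card {0<..2 * k - b} + card {0<..2 * k - c} = 6 * k + 1 - (a + b + c)"
    using T(10-12) by simp
  then have large: "4 * k \<le> card {..2 * k - a} + card {0<..2 * k - b} + card {0<..2 * k - c}"
    using outer_face[OF Tet] by linarith
  obtain z where z: "4 \<le> card {t \<in> {..2 * k - a}. (z, X t) \<in> R}
      + card {t \<in> {0<..2 * k - b}. (z, Y t) \<in> R} + card {t \<in> {0<..2 * k - c}. (z, Z t) \<in> R}"
    by (rule four_neighbours[OF finite_atMost finite_greaterThanAtMost finite_greaterThanAtMost _
          V[OF T(1)] V[OF T(2)] V[OF T(3)] large]) auto
  have fin: "finite (neighbours z X' i' j')" for X' i' j' by (simp add: neighbours_def)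
  have split: "{t \<in> {0<..j}. (z, F t) \<in> R} = neighbours z F 0 i \<union> neighbours z F i j" if "i \<le> j" for F i j
    using that by (auto simp: neighbours_def)
  have card_split: "card {t \<in> {0<..j}. (z, F t) \<in> R} = card (neighbours z F 0 i) + card (neighbours z F i j)"
    if "i \<le> j" for F i j
    unfolding split[OF that] by (rule card_Un_disjoint) (use fin in \<open>auto simp: neighbours_def\<close>)
  have "{t \<in> {..2 * k - a}. (z, X t) \<in> R} =
      {t. t = 0 \<and> (z, X 0) \<in> R} \<union> {t \<in> {0<..2 * k - a}. (z, X t) \<in> R}" by auto
  then have "card {t \<in> {..2 * k - a}. (z, X t) \<in> R} =
      card {t::nat. t = 0 \<and> (z, X 0) \<in> R} + card {t \<in> {0<..2 * k - a}. (z, X t) \<in> R}"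
    by (simp only:, subst card_Un_disjoint) auto
  also have "card {t::nat. t = 0 \<and> (z, X 0) \<in> R} = of_bool ((z, X 0) \<in> R)" by simp
  finally have sum: "4 \<le> of_bool ((z, X 0) \<in> R) + card (neighbours z X 0 c) + card (neighbours z X c (2 * k - a))
      + card (neighbours z Y 0 a) + card (neighbours z Y a (2 * k - b))
      + card (neighbours z Z 0 b) + card (neighbours z Z b (2 * k - c))"
    using z card_split[of c "2 * k - a" X] card_split[of a "2 * k - b" Y] card_split[of b "2 * k - c" Z]
      T(10-12) by simp
  note F = tetrahedron_faces[OF Tet, of z]
  note R1 = max_tetrahedron_rotate[OF M] and R2 = max_tetrahedron_rotate[OF max_tetrahedron_rotate[OF M]]
  note o = tetrahedron_origin[OF Tet]
  show False
  proof (cases "(z, X 0) \<in> R")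
    case True
    then have "1 \<le> card (neighbours z X c (2 * k - a))" "1 \<le> card (neighbours z Y a (2 * k - b))"
      "1 \<le> card (neighbours z Z b (2 * k - c))"
      using F sum by simp_all
    then show False using no_origin_neighbour[OF Tet True] neighbours_obtain by metis
  next
    case False
    with F sum have F: "card (neighbours z X 0 c) + card (neighbours z X c (2 * k - a)) + card (neighbours z Y 0 a) \<le> 2"
      "card (neighbours z Y 0 a) + card (neighbours z Y a (2 * k - b)) + card (neighbours z Z 0 b) \<le> 2"
      "card (neighbours z Z 0 b) + card (neighbours z Z b (2 * k - c)) + card (neighbours z X 0 c) \<le> 2"
      and sum: "4 \<le> card (neighbours z X 0 c) + card (neighbours z X c (2 * k - a))
      + card (neighbours z Y 0 a) + card (neighbours z Y a (2 * k - b))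
      + card (neighbours z Z 0 b) + card (neighbours z Z b (2 * k - c))" by simp_all
    have "\<not> 1 \<le> card (neighbours z Z 0 b)"
      using no_leg_neighbour[OF M False sum] by blast
    moreover have "\<not> 1 \<le> card (neighbours z X 0 c)"
      using no_leg_neighbour[OF R1, of z] False o sum by (simp add: add_ac, blast)
    moreover have "\<not> 1 \<le> card (neighbours z Y 0 a)"
      using no_leg_neighbour[OF R2, of z] False o sum by (simp add: add_ac, blast)
    ultimately have "card (neighbours z X c (2 * k - a)) \<le> 2" "card (neighbours z Y a (2 * k - b)) \<le> 2"
      "card (neighbours z Z b (2 * k - c)) \<le> 2"
      "4 \<le> card (neighbours z X c (2 * k - a)) + card (neighbours z Y a (2 * k - b))
        + card (neighbours z Z b (2 * k - c))"
      using F sum by linarith+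
    from three_summands_ge_4[OF this] show False
      using no_interior_neighbours[OF M, of z] no_interior_neighbours[OF R1, of z]
        no_interior_neighbours[OF R2, of z] by (elim disjE conjE) blast+
  qed
qed

lemma no_tetrahedron: "\<not> tetrahedron X Y Z a b c"
proof
  assume Tet: "tetrahedron X Y Z a b c"
  let ?P = "\<lambda>(X, Y, Z, a, b, c). tetrahedron X Y Z a b c"
  let ?f = "\<lambda>(X, Y, Z, a, b, c). a + b + c :: nat"
  have start: "?P (X, Y, Z, a, b, c)" using Tet by simp
  have bound: "\<forall>T. ?P T \<longrightarrow> ?f T < Suc L"
    unfolding split_paired_All prod.case less_Suc_eq_le using outer_face by blast
  obtain T where T: "?P T \<and> (\<forall>T'. ?P T' \<longrightarrow> ?f T' \<le> ?f T)"
    using ex_has_greatest_nat[of ?P, OF start bound] by (elim exE)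
  obtain X Y Z a b c where "T = (X, Y, Z, a, b, c)" by (cases T)
  then have "max_tetrahedron X Y Z a b c"
    using T unfolding max_tetrahedron_def split_paired_All prod.case by simp
  then show False using no_max_tetrahedron by blast
qed

section \<open>The homomorphism\<close>

text \<open>Periodic extension lets the index \<open>i + 2\<close> run past the end of the closed
  walk.\<close>

definition periodic_walk where
  "periodic_walk C \<longleftrightarrow> (\<forall>t. (C t, C (Suc t)) \<in> R) \<and> (\<forall>t. C (t + L) = C t)"

text \<open>Such an \<open>x\<close> can replace \<open>C (i + 1)\<close>.\<close>

definition seen_by where
  "seen_by C x \<longleftrightarrow> (\<exists>i. (x, C i) \<in> R \<and> (x, C (i + 2)) \<in> R)"

text \<open>In a shortest odd closed walk longer than \<open>L\<close>, vertices three steps apart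
  are non-adjacent, since an edge would shorten the walk by two. Their walk of length
  \<open>2k - 2\<close> closes the three steps to length \<open>L\<close>.\<close>

lemma odd_walk_imp_closed_walk:
  assumes "(x, x) \<in> R ^^ n" "odd n"
  obtains X where "closed_walk X"
proof -
  define m where "m = (LEAST n. odd n \<and> (\<exists>x. (x, x) \<in> R ^^ n))"
  have least: "m \<le> n'" if "(y, y) \<in> R ^^ n'" "odd n'" for y n'
    unfolding m_def by (rule Least_le) (use that in blast)
  have "odd m \<and> (\<exists>x. (x, x) \<in> R ^^ m)"
    unfolding m_def by (rule LeastI_ex) (use assms in blast)
  then obtain y where m: "odd m" "(y, y) \<in> R ^^ m" by blast
  then obtain X where X: "X 0 = y" "X m = y" "\<And>t. t < m \<Longrightarrow> (X t, X (Suc t)) \<in> R"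
    unfolding relpow_fun_conv by blast
  have "L \<le> m" using odd_closed[OF m(2,1)] .
  have "m = L"
  proof (rule ccontr)
    assume "m \<noteq> L"
    then have "L < m" using \<open>L \<le> m\<close> by simp
    then have m3: "3 < m" using k_ge_2 by linarith
    have seg: "(X i, X j) \<in> R ^^ (j - i)" if "i \<le> j" "j \<le> m" for i j
      by (rule walk_segment) (use X(3) that in auto)
    have s: "(X 0, X 3) \<in> R ^^ 3" "(X 3, X 0) \<in> R ^^ (m - 3)"
      using seg[of 0 3] seg[of 3 m] m3 X(1,2) by simp_all
    have "(X 0, X 3) \<notin> R"
    proof
      assume "(X 0, X 3) \<in> R"
      then have "(X 0, X 0) \<in> R ^^ (1 + (m - 3))" using relpow_trans[OF _ s(2), of "X 0" 1] by simp
      moreover have "odd (1 + (m - 3))" using m(1) m3 by simp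
      ultimately have "m \<le> 1 + (m - 3)" by (rule least)
      then show False using m3 by linarith
    qed
    moreover have "X 0 \<in> V" "X 3 \<in> V" using X(3)[of 0] X(3)[of 3] adj_V m3 by auto
    ultimately have "(X 0, X 3) \<in> R ^^ (2 * k - 2)" by (intro nonadjacent_walk)
    from relpow_trans[OF s(1) relpow_sym[OF sym_R this]]
    have "(X 0, X 0) \<in> R ^^ (3 + (2 * k - 2))" .
    moreover have "3 + (2 * k - 2) = L" using k_ge_2 by simp
    ultimately have "m \<le> L" by (intro least) auto
    then show False using \<open>L < m\<close> by simp
  qed
  then have "closed_walk X" using X by (simp add: closed_walk_def)
  then show thesis by (rule that)
qed

lemma closed_walk_imp_periodic:
  assumes "closed_walk X"
  shows "periodic_walk (\<lambda>t. X (t mod L))"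
  unfolding periodic_walk_def
proof (intro conjI allI)
  fix t
  have lt: "t mod L < L" by simp
  have "X (Suc t mod L) = X (Suc (t mod L))"
  proof (cases "Suc (t mod L) = L")
    case True
    then have "Suc t mod L = 0" by (metis mod_Suc)
    then show ?thesis using True assms by (simp add: closed_walk_def)
  next
    case False
    then have "Suc t mod L = Suc (t mod L)" by (metis mod_Suc)
    then show ?thesis by simp
  qed
  then show "(X (t mod L), X (Suc t mod L)) \<in> R"
    using assms lt unfolding closed_walk_def by metis
  show "X ((t + L) mod L) = X (t mod L)" by (simp only: mod_add_self2)
qed

lemma periodic_walkD:
  assumes "periodic_walk C"
  shows "(C t, C (Suc t)) \<in> R" "C (t + L) = C t" "closed_walk (\<lambda>t. C (i + t))"
  using assms unfolding periodic_walk_def closed_walk_def by (auto simp flip: add.assoc)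

lemma periodic_walk_mod:
  assumes "periodic_walk C"
  shows "C (t mod L + e) = C (t + e)"
proof -
  have *: "C (s + n * L) = C s" for s n
  proof (induction n)
    case (Suc n)
    have "s + Suc n * L = s + n * L + L" by simp
    then show ?case using Suc periodic_walkD(2)[OF assms, of "s + n * L"] by metis
  qed simp
  have "t + e = t mod L + e + t div L * L" using div_mult_mod_eq[of t L] by linarith
  then show ?thesis using *[of "t mod L + e" "t div L"] by metis
qed

text \<open>The edge yields walks of length 3 between neighbours of \<open>x\<close> and
  \<open>y\<close> on \<open>C\<close>. They are compared with even arcs: from
  \<open>C (i + 2)\<close> to \<open>C j\<close> if \<open>j - i\<close> is even and positive, and
  from \<open>C (j + 2)\<close> around to \<open>C i\<close> if it is odd.\<close>

lemma adjacent_positions: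
  assumes C: "periodic_walk C" and xy: "(x, y) \<in> R"
    and x: "(x, C i) \<in> R" "(x, C (i + 2)) \<in> R" and y: "(y, C j) \<in> R" "(y, C (j + 2)) \<in> R"
    and ij: "i \<le> j" "j < L"
  shows "j = Suc i \<or> i = 0 \<and> j = 2 * k"
proof -
  define d where "d = j - i"
  let ?F = "\<lambda>t. C (i + t)"
  have F: "closed_walk ?F" using periodic_walkD(3)[OF C] .
  have j: "j = i + d" using ij by (simp add: d_def)
  have three: "(p, q) \<in> R ^^ 3" if "(x, p) \<in> R" "(y, q) \<in> R" for p q
  proof -
    have "(p, x) \<in> R" using that(1) by (rule adj_sym)
    with xy that(2) show ?thesis by (auto simp: numeral_3_eq_3)
  qed
  show ?thesis
  proof (cases "even d")
    case True
    show ?thesis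
    proof (cases "d = 0")
      case True
      have "(C i, C i) \<in> R ^^ 3" using three[OF x(1) y(1)] True j by simp
      then have "L \<le> 3" using odd_closed by fastforce
      then show ?thesis using k_ge_2 by simp
    next
      case False
      have "d \<noteq> 1" using True by (metis odd_one)
      then have d2: "2 \<le> d" "d \<le> 2 * k" using False j ij by linarith+
      have "L \<le> d - 2 + 3"
      proof (rule parity)
        show "(?F 2, ?F d) \<in> R ^^ (d - 2)" using closed_walk_segment(1)[OF F, of 2 d] d2 by simp
        show "(?F 2, ?F d) \<in> R ^^ 3" using three[OF x(2) y(1)] j by simp
      qed (use True d2 in simp)
      then show ?thesis using d2 ij j by linarith
    qed
  next
    case False
    then have "d \<noteq> 2 * k" by auto
    then have d: "d + 2 \<le> L" using ij by (simp add: d_def)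
    have "L \<le> L - (d + 2) + 3"
    proof (rule parity)
      show "(?F 0, ?F (d + 2)) \<in> R ^^ (L - (d + 2))" using closed_walk_back(2)[OF F d] .
      show "(?F 0, ?F (d + 2)) \<in> R ^^ 3" using three[OF x(1) y(2)] j by (simp add: add.assoc)
    qed (use False d in simp)
    then have "d \<le> 1" using d by linarith
    moreover have "d \<noteq> 0" using False by (metis even_zero)
    ultimately show ?thesis using j by linarith
  qed
qed

lemma all_seen_imp_homomorphism:
  assumes C: "periodic_walk C" and seen: "\<And>x. x \<in> V \<Longrightarrow> seen_by C x"
  shows "\<exists>\<phi>. (\<forall>x\<in>V. \<phi> x < L) \<and> (\<forall>(x, y)\<in>R. \<phi> y = Suc (\<phi> x) mod L \<or> \<phi> x = Suc (\<phi> y) mod L)"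
proof -
  have "\<exists>i<L. (x, C i) \<in> R \<and> (x, C (i + 2)) \<in> R" if x: "x \<in> V" for x
  proof -
    obtain i where "(x, C i) \<in> R" "(x, C (i + 2)) \<in> R" using seen[OF x] unfolding seen_by_def by blast
    then have "(x, C (i mod L)) \<in> R" "(x, C (i mod L + 2)) \<in> R"
      using periodic_walk_mod[OF C, of i 0] periodic_walk_mod[OF C, of i 2] by simp_all
    then show ?thesis by (intro exI[of _ "i mod L"]) simp
  qed
  then obtain \<phi> where \<phi>: "\<And>x. x \<in> V \<Longrightarrow> \<phi> x < L \<and> (x, C (\<phi> x)) \<in> R \<and> (x, C (\<phi> x + 2)) \<in> R"
    by metis
  have "\<phi> y = Suc (\<phi> x) mod L \<or> \<phi> x = Suc (\<phi> y) mod L" if xy: "(x, y) \<in> R" for x y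
  proof -
    have V: "x \<in> V" "y \<in> V" using xy adj_V by auto
    have *: "\<phi> v = Suc (\<phi> u) mod L \<or> \<phi> u = Suc (\<phi> v) mod L"
      if "(u, v) \<in> R" "u \<in> V" "v \<in> V" "\<phi> u \<le> \<phi> v" for u v
      using adjacent_positions[OF C that(1), of "\<phi> u" "\<phi> v"] \<phi>[OF that(2)] \<phi>[OF that(3)] that(4) by auto
    show ?thesis
      using *[OF xy V] *[OF adj_sym[OF xy] V(2,1)] by linarith
  qed
  then show ?thesis using \<phi> by blast
qed

lemma unseen_neighbour_tetrahedron:
  assumes C: "periodic_walk C" and y: "(y, C i) \<in> R" "(y, C (i + 2)) \<in> R"
    and xy: "(x, y) \<in> R" and unseen: "\<not> seen_by C x"
  shows "\<exists>X Y Z. tetrahedron X Y Z 2 1 2"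
proof -
  have step: "(C s, C t) \<in> R" if "t = Suc s" for s t using periodic_walkD(1)[OF C] that by simp
  have per: "C (t + 2 * k + 1) = C t" for t using periodic_walkD(2)[OF C, of t] by (simp add: add.assoc)
  note W = periodic_walkD(3)[OF C, of i]
  \<comment> \<open>\<open>y\<close> replaces \<open>C (i + 1)\<close>, and the indices are shifted
    so that it becomes the origin.\<close>
  define D where "D t = (if t = 0 \<or> t = L then y else C (i + 1 + t))" for t
  have D0: "D 0 = y" "D L = y" by (simp_all add: D_def)
  have Dt: "D t = C (i + 1 + t)" if "0 < t" "t < L" for t
    using that by (simp add: D_def)
  have yi: "(y, C (i + 1 + 2 * k)) \<in> R" using y(1) per[of i] by (simp add: add_ac)
  have D: "closed_walk D"
    unfolding closed_walk_def
  proof (intro conjI allI impI)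
    fix t assume "t < L"
    then consider "t = 0" | "0 < t" "t < 2 * k" | "t = 2 * k" by linarith
    then show "(D t, D (Suc t)) \<in> R"
    proof cases
      case 1
      then show ?thesis using D0 Dt[of 1] y(2) k_ge_2 by simp
    next
      case 2
      then show ?thesis using Dt[of t] Dt[of "Suc t"] step by simp
    next
      case 3
      then show ?thesis using D0 Dt[of "2 * k"] yi adj_sym k_ge_2 by simp
    qed
  qed (simp only: D0)
  have "(x, C (i + 3)) \<notin> R"
  proof
    assume x: "(x, C (i + 3)) \<in> R"
    \<comment> \<open>The hexagon \<open>y\<close>, \<open>C i\<close>, ...,
      \<open>C (i + 3)\<close>, \<open>x\<close> has the diagonal from \<open>y\<close> to
      \<open>C (i + 2)\<close>. A second one would be a chord of \<open>C\<close> or make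
      \<open>x\<close> seen.\<close>
    have "(C (i + 1), x) \<notin> R" using unseen x adj_sym unfolding seen_by_def by (force simp: eval_nat_numeral)
    moreover have "(C i, C (i + 3)) \<notin> R"
      using closed_walk_chord[OF W, of 0 3] k_ge_2 by auto
    moreover have "(C i, C (i + 3)) \<in> R \<or> (C (i + 1), x) \<in> R"
      by (rule hexagon[OF y(1) step step step adj_sym[OF x] xy y(2)]) simp_all
    ultimately show False by blast
  qed
  then have n1: "(x, D 2) \<notin> R" using Dt[of 2] k_ge_2 by (simp add: eval_nat_numeral)
  have "(x, C (i + 2 * k)) \<notin> R"
  proof
    assume x: "(x, C (i + 2 * k)) \<in> R"
    have e: "C (i + 2 * k + 2) = C (i + 1)" "C (i + 2 * k + 1) = C i"
      using per[of "i + 1"] per[of i] by (simp_all add: add_ac)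
    then have "(C (i + 1), x) \<notin> R" using unseen x adj_sym unfolding seen_by_def by metis
    moreover have "(C (i + 2), C (i + 2 * k)) \<notin> R"
      using closed_walk_chord[OF W, of 2 "2 * k"] k_ge_2 by auto
    moreover have "(C (i + 2), C (i + 2 * k)) \<in> R \<or> (C (i + 1), x) \<in> R"
    proof (rule hexagon[OF y(2) _ _ _ adj_sym[OF x] xy y(1)])
      show "(C (i + 2), C (i + 1)) \<in> R" "(C (i + 1), C i) \<in> R" by (rule adj_sym, rule step, simp)+
      show "(C i, C (i + 2 * k)) \<in> R" using adj_sym[OF step[of "i + 2 * k + 1" "i + 2 * k"]] unfolding e(2) by simp
    qed
    ultimately show False by blast
  qed
  then have n2: "(D (2 * k - 1), x) \<notin> R" using Dt[of "2 * k - 1"] k_ge_2 adj_sym by fastforce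
  have "D t \<in> V" if "t < L" for t
    using D that adj_V(1) unfolding closed_walk_def by blast
  then have V: "x \<in> V" "D 2 \<in> V" "D (2 * k - 1) \<in> V"
    using adj_V(1)[OF xy] k_ge_2 by simp_all
  obtain P where P: "P 0 = x" "P (2 * k - 2) = D 2" "\<And>t. t < 2 * k - 2 \<Longrightarrow> (P t, P (Suc t)) \<in> R"
    using nonadjacent_walk_obtain[OF V(1,2) n1] by metis
  obtain Q where Q: "Q 0 = D (2 * k - 1)" "Q (2 * k - 2) = x" "\<And>t. t < 2 * k - 2 \<Longrightarrow> (Q t, Q (Suc t)) \<in> R"
    using nonadjacent_walk_obtain[OF V(3,1) n2] by metis
  have Dstep: "(D s, D t) \<in> R" if "t = Suc s" "s < L" for s t
    using D that by (simp add: closed_walk_def)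
  define Z where "Z t = (if t = 0 then y else if t \<le> 2 * k - 1 then P (t - 1) else D (L - t))" for t
  define Y where "Y t = (if t \<le> 1 then D (L - t) else if t \<le> 2 * k then Q (t - 2) else y)" for t
  have "closed_walk Z"
    unfolding closed_walk_def
  proof (intro conjI allI impI)
    fix t assume "t < L"
    then consider "t = 0" | "0 < t" "t < 2 * k - 1" | "t = 2 * k - 1" | "t = 2 * k" by linarith
    then show "(Z t, Z (Suc t)) \<in> R"
    proof cases
      case 1
      then show ?thesis using P(1) xy adj_sym k_ge_2 by (simp add: Z_def)
    next
      case 2
      then have "t - 1 < 2 * k - 2" "Suc (t - 1) = t" by linarith+
      then show ?thesis using P(3)[of "t - 1"] 2 by (simp add: Z_def)
    next
      case 3
      have "t - 1 = 2 * k - 2" "L - Suc t = 1" "\<not> Suc t \<le> 2 * k - 1" "t \<noteq> 0" using 3 k_ge_2 by linarith+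
      then have "Z t = D 2" "Z (Suc t) = D 1" using P(2) 3 by (simp_all add: Z_def)
      then show ?thesis using adj_sym[OF Dstep[of 2 1]] k_ge_2 by simp
    next
      case 4
      have "\<not> t \<le> 2 * k - 1" "L - t = 1" "t \<noteq> 0" using 4 k_ge_2 by linarith+
      then have "Z t = D 1" "Z (Suc t) = D 0" using 4 by (simp_all add: Z_def)
      then show ?thesis using adj_sym[OF Dstep[of 1 0]] k_ge_2 by simp
    qed
  next
    have "\<not> L \<le> 2 * k - 1" "L \<noteq> 0" by linarith+
    then show "Z L = Z 0" using D0 unfolding Z_def by simp
  qed
  moreover have "closed_walk Y"
    unfolding closed_walk_def
  proof (intro conjI allI impI)
    fix t assume "t < L"
    then consider "t = 0" | "t = 1" | "2 \<le> t" "t < 2 * k" | "t = 2 * k" by linarith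
    then show "(Y t, Y (Suc t)) \<in> R"
    proof cases
      case 1
      then show ?thesis using adj_sym[OF Dstep[of L "2 * k"]] by (simp add: Y_def)
    next
      case 2
      then show ?thesis using adj_sym[OF Dstep[of "2 * k" "2 * k - 1"]] Q(1) k_ge_2 by (simp add: Y_def)
    next
      case 3
      then have "t - 2 < 2 * k - 2" "Suc (t - 2) = Suc t - 2" by linarith+
      then show ?thesis using Q(3)[of "t - 2"] 3 by (simp add: Y_def)
    next
      case 4
      then show ?thesis using Q(2) xy k_ge_2 by (simp add: Y_def)
    qed
  next
    show "Y L = Y 0" using D0 k_ge_2 by (simp add: Y_def)
  qed
  moreover have "Y t = D (L - t)" if "t \<le> 2" for t
  proof (cases "t = 2")
    case True
    then show ?thesis using Q(1) k_ge_2 by (simp add: Y_def)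
  qed (use that in \<open>simp add: Y_def\<close>)
  moreover have "Z t = Y (L - t)" if "t \<le> 1" for t
  proof (cases "t = 0")
    case True
    then show ?thesis using k_ge_2 by (simp add: Y_def Z_def)
  next
    case False
    then have "t = 1" "1 \<le> 2 * k - 1" using that k_ge_2 by linarith+
    then show ?thesis using k_ge_2 P(1) Q(2) by (simp add: Y_def Z_def)
  qed
  moreover have "D t = Z (L - t)" if "t \<le> 2" for t
  proof (cases "t = 2")
    case True
    have "L - t - 1 = 2 * k - 2" "L - t \<le> 2 * k - 1" "L - t \<noteq> 0" using True k_ge_2 by linarith+
    then show ?thesis using P(2) True by (simp add: Z_def)
  next
    case False
    have "\<not> L - t \<le> 2 * k - 1" "L - t \<noteq> 0" "L - (L - t) = t" using False that k_ge_2 by linarith+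
    then show ?thesis by (simp add: Z_def)
  qed
  ultimately have "tetrahedron D Y Z 2 1 2"
    unfolding tetrahedron_def using D k_ge_2 by simp
  then show ?thesis by blast
qed

text \<open>Edge-maximality gives connectedness, both for spreading \<open>seen_by\<close> and for
  the bipartite colouring.\<close>

lemma connected:
  assumes "u \<in> V" "v \<in> V"
  obtains n where "(u, v) \<in> R ^^ n"
  using nonadjacent_walk[OF assms] relpow_1[of R] by metis

lemma all_seen:
  assumes C: "periodic_walk C" and "x \<in> V"
  shows "seen_by C x"
proof (rule ccontr)
  assume x: "\<not> seen_by C x"
  have C1: "(C 1, C 0) \<in> R" "(C 1, C (0 + 2)) \<in> R"
    using periodic_walkD(1)[OF C, of 0] periodic_walkD(1)[OF C, of 1] adj_sym by (simp_all add: numeral_2_eq_2)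
  then have "seen_by C (C 1)" unfolding seen_by_def by blast
  moreover obtain n where "(C 1, x) \<in> R ^^ n" using connected[OF _ assms(2)] C1 adj_V by metis
  ultimately obtain y z where "(y, z) \<in> R" "seen_by C y" "\<not> seen_by C z"
    using walk_leaves_set[where P = "seen_by C"] x by blast
  then show False
    using unseen_neighbour_tetrahedron[OF C] no_tetrahedron adj_sym unfolding seen_by_def by metis
qed

text \<open>Parities of walks from a fixed vertex give a proper 2-colouring, mapped onto the edge
  between 0 and 1 of the cycle.\<close>

lemma bipartite_imp_homomorphism:
  assumes even: "\<And>x n. (x, x) \<in> R ^^ n \<Longrightarrow> even n"
  shows "\<exists>\<phi>. (\<forall>x\<in>V. \<phi> x < L) \<and> (\<forall>(x, y)\<in>R. \<phi> y = Suc (\<phi> x) mod L \<or> \<phi> x = Suc (\<phi> y) mod L)"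
proof (cases "V = {}")
  case True
  then show ?thesis using R_subset by auto
next
  case False
  then obtain v where v: "v \<in> V" by blast
  define \<phi> where "\<phi> x = (SOME n. (v, x) \<in> R ^^ n) mod 2" for x
  have walk: "(v, x) \<in> R ^^ (SOME n. (v, x) \<in> R ^^ n)" if "x \<in> V" for x
    by (rule connected[OF v that]) (rule someI)
  have flip: "\<phi> x = 0 \<and> \<phi> y = 1 \<or> \<phi> x = 1 \<and> \<phi> y = 0" if xy: "(x, y) \<in> R" for x y
  proof -
    let ?m = "SOME n. (v, x) \<in> R ^^ n" and ?n = "SOME n. (v, y) \<in> R ^^ n"
    have "(v, y) \<in> R ^^ Suc ?m" using relpow_Suc_I[OF walk xy] adj_V(1)[OF xy] by simp
    from relpow_trans[OF this relpow_sym[OF sym_R walk]] adj_V(2)[OF xy]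
    have "even (Suc ?m + ?n)" by (intro even) simp
    then show ?thesis unfolding \<phi>_def by presburger
  qed
  have "\<phi> x < L" for x unfolding \<phi>_def using k_ge_2 by (intro less_trans[OF mod_less_divisor]) simp_all
  moreover have "Suc 0 mod L = 1" using k_ge_2 by simp
  ultimately show ?thesis using flip by (intro exI[of _ \<phi>]) fastforce
qed

lemma homomorphism_exists:
  "\<exists>\<phi>. (\<forall>x\<in>V. \<phi> x < L) \<and> (\<forall>(x, y)\<in>R. \<phi> y = Suc (\<phi> x) mod L \<or> \<phi> x = Suc (\<phi> y) mod L)"
proof (cases "\<exists>x n. (x, x) \<in> R ^^ n \<and> odd n")
  case True
  then obtain X where "closed_walk X" using odd_walk_imp_closed_walk by blast
  then show ?thesis using all_seen_imp_homomorphism[OF closed_walk_imp_periodic] all_seen[OF closed_walk_imp_periodic] by blast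
next
  case False
  then show ?thesis by (intro bipartite_imp_homomorphism) blast
qed

end

theorem theorem1p2:
  fixes k n :: nat and G :: "'a pair_pre_digraph"
  assumes "k \<ge> 2"
    and "pair_graph G"
    and "card (pverts G) = n"
    and "real (min_degree G) > 3 * real n / (4 * real k)"
    and "odd_girth_at_least G (2 * k + 1)"
  shows "homomorphic_to G (cycle_graph (2 * k + 1))"
proof -
  interpret pair_graph G by (rule assms(2))
  let ?V = "pverts G" and ?R = "parcs G"
  have sub: "?R \<subseteq> ?V \<times> ?V" using in_arcsD1 in_arcsD2 by auto
  have sym: "sym ?R" using pair_sym_arcs by (simp add: symmetric_def)
  have closed: "2 * k + 1 \<le> m" if walk: "(x, x) \<in> ?R ^^ m" and "odd m" for x m
  proof -
    have "x \<in> ?V"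
    proof -
      obtain m' where "m = Suc m'" using \<open>odd m\<close> by (cases m) auto
      then show ?thesis using walk in_arcsD2 by auto
    qed
    then obtain p where "awalk x p x" "length p = m" using relpow_imp_awalk[OF walk] by blast
    then obtain c where "cycle c" "odd (length c)" "length c \<le> m"
      using odd_closed_walk_imp_odd_cycle[of x p] \<open>odd m\<close> by auto
    then show ?thesis using assms(5) unfolding odd_girth_at_least_def by (meson le_trans not_less)
  qed
  \<comment> \<open>Degrees in \<open>S\<close> are at least those in \<open>G\<close>, and a
    homomorphism defined on \<open>S\<close> is also one on \<open>G\<close>.\<close>
  obtain S where S: "?R \<subseteq> S" "S \<subseteq> ?V \<times> ?V" "sym S"
    "\<forall>x m. (x, x) \<in> S ^^ m \<longrightarrow> odd m \<longrightarrow> 2 * k + 1 \<le> m"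
    "\<forall>u\<in>?V. \<forall>v\<in>?V. (u, v) \<notin> S \<longrightarrow> (\<exists>m. even m \<and> Suc m < 2 * k + 1 \<and> (u, v) \<in> S ^^ m)"
    by (rule saturate[OF pair_finite_verts sub sym closed])
  have degree: "3 * card ?V < 4 * k * card (S `` {v})" if v: "v \<in> ?V" for v
  proof -
    have "out_arcs (with_proj G) v = Pair v ` (?R `` {v})" by (auto simp: out_arcs_def)
    then have "out_degree (with_proj G) v = card (?R `` {v})"
      unfolding out_degree_def by (simp add: card_image inj_on_def)
    moreover have "card (?R `` {v}) \<le> card (S `` {v})"
      by (rule card_mono) (use S(1,2) pair_finite_verts in \<open>auto intro: finite_subset[of _ ?V]\<close>)
    moreover have "min_degree G \<le> out_degree (with_proj G) v"
      unfolding min_degree_def using v pair_finite_verts by (intro Min_le) auto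
    ultimately have "4 * k * min_degree G \<le> 4 * k * card (S `` {v})" by simp
    moreover have "3 * real n < 4 * real k * real (min_degree G)"
      using assms(1,4) by (simp add: divide_less_eq mult.commute)
    then have "real (3 * n) < real (4 * k * min_degree G)" by simp
    then have "3 * n < 4 * k * min_degree G" by (simp only: of_nat_less_iff)
    ultimately show ?thesis using assms(3) by linarith
  qed
  interpret saturated_graph ?V S k
    by unfold_locales (use assms(1) pair_finite_verts S degree in auto)
  obtain \<phi> where \<phi>: "\<And>x. x \<in> ?V \<Longrightarrow> \<phi> x < 2 * k + 1"
    "\<And>x y. (x, y) \<in> S \<Longrightarrow> \<phi> y = Suc (\<phi> x) mod (2 * k + 1) \<or> \<phi> x = Suc (\<phi> y) mod (2 * k + 1)"
    using homomorphism_exists by blast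
  have "graph_hom G (cycle_graph (2 * k + 1)) \<phi>"
    unfolding graph_hom_def cycle_graph_def
    using \<phi> S(1) sub by (auto simp del: mod_Suc_eq mod_Suc)
  then show ?thesis unfolding homomorphic_to_def by blast
qed

end
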